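(* Let $M$ be the group von Neumann algebra of the right-angled Artin group with generators $u_1,v_1,v_2,v_3,u_2$ whose only relations are $[u_1,v_1]=[v_1,v_2]=[v_2,v_3]=[v_3,u_2]=1$ (the graph product of copies of $L(\mathbb Z)$ over the path graph $u_1 - v_1 - v_2 - v_3 - u_2$), and identify the generators with the corresponding canonical Haar unitaries in $M$. Then $p_M(u_1,u_2)=4$.
   Context: $M$ carries its canonical trace $\tau$. A unitary $u$ is Haar if $\tau(u^n)=0$ for all $n\ge1$; $\mathcal H(N)$ denotes the set of Haar unitaries of $N$. Fix a free ultrafilter $\mathcal U$ on $\mathbb N$, $M^{\mathcal U}$ the tracial ultrapower containing $M$ diagonally. For $u,v\in\mathcal H(M)$: $p_M(u,u)=0$; for $u\ne v$, $p_M(u,v)$ is the least $k\ge1$ such that there exist $w_1,\ldots,w_{k-1}\in\mathcal H(M^{\mathcal U})$ with $[w_i,w_{i+1}]=0$ for $0\le i\le k-1$, where $w_0=u,w_k=v$; $p_M(u,v)=\infty$ if none exists. *)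

theory Defs
  imports "HOL-Analysis.Analysis" "HOL-Algebra.Group" "HOL-Library.Extended_Nat"
begin

text \<open>An element x of L(G) is identified with the vector x delta_e in l^2(G):
 L(G) = set of l^2 functions whose left convolution is bounded on finitely
 supported vectors. Product = convolution, trace = value at the unit.\<close>

definition ell2 :: "('g, 'm) monoid_scheme \<Rightarrow> ('g \<Rightarrow> complex) set" where
  "ell2 G = {f. (\<forall>x. x \<notin> carrier G \<longrightarrow> f x = 0) \<and>
                 (\<lambda>x. (cmod (f x))\<^sup>2) summable_on carrier G}"

definition norm2 :: "('g, 'm) monoid_scheme \<Rightarrow> ('g \<Rightarrow> complex) \<Rightarrow> real" where
  "norm2 G f = sqrt (\<Sum>\<^sub>\<infinity>x\<in>carrier G. (cmod (f x))\<^sup>2)"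

definition conv :: "('g, 'm) monoid_scheme \<Rightarrow> ('g \<Rightarrow> complex) \<Rightarrow> ('g \<Rightarrow> complex) \<Rightarrow> 'g \<Rightarrow> complex" where
  "conv G f g x = (if x \<in> carrier G then
      (\<Sum>\<^sub>\<infinity>y\<in>carrier G. f y * g (inv\<^bsub>G\<^esub> y \<otimes>\<^bsub>G\<^esub> x)) else 0)"

definition delta :: "'g \<Rightarrow> 'g \<Rightarrow> complex" where
  "delta g = (\<lambda>h. if h = g then 1 else 0)"

definition unitL :: "('g, 'm) monoid_scheme \<Rightarrow> 'g \<Rightarrow> complex" where
  "unitL G = delta \<one>\<^bsub>G\<^esub>"

definition adjL :: "('g, 'm) monoid_scheme \<Rightarrow> ('g \<Rightarrow> complex) \<Rightarrow> 'g \<Rightarrow> complex" where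
  "adjL G f x = (if x \<in> carrier G then cnj (f (inv\<^bsub>G\<^esub> x)) else 0)"

definition traceL :: "('g, 'm) monoid_scheme \<Rightarrow> ('g \<Rightarrow> complex) \<Rightarrow> complex" where
  "traceL G f = f \<one>\<^bsub>G\<^esub>"

definition powL :: "('g, 'm) monoid_scheme \<Rightarrow> ('g \<Rightarrow> complex) \<Rightarrow> nat \<Rightarrow> 'g \<Rightarrow> complex" where
  "powL G f k = (conv G f ^^ k) (unitL G)"

definition fin_supp :: "('g, 'm) monoid_scheme \<Rightarrow> ('g \<Rightarrow> complex) \<Rightarrow> bool" where
  "fin_supp G f \<longleftrightarrow> finite {x. f x \<noteq> 0} \<and> {x. f x \<noteq> 0} \<subseteq> carrier G"

definition op_bound :: "('g, 'm) monoid_scheme \<Rightarrow> ('g \<Rightarrow> complex) \<Rightarrow> real \<Rightarrow> bool" where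
  "op_bound G f C \<longleftrightarrow> (\<forall>\<xi>. fin_supp G \<xi> \<longrightarrow> norm2 G (conv G f \<xi>) \<le> C * norm2 G \<xi>)"

definition vnL :: "('g, 'm) monoid_scheme \<Rightarrow> ('g \<Rightarrow> complex) set" where
  "vnL G = {f \<in> ell2 G. \<exists>C. op_bound G f C}"

definition haarL :: "('g, 'm) monoid_scheme \<Rightarrow> ('g \<Rightarrow> complex) set" where
  "haarL G = {u \<in> vnL G. conv G (adjL G u) u = unitL G \<and> conv G u (adjL G u) = unitL G
                \<and> (\<forall>n\<ge>1. traceL G (powL G u n) = 0)}"

definition free_ultrafilter :: "nat filter \<Rightarrow> bool" where
  "free_ultrafilter F \<longleftrightarrow> F \<noteq> bot \<and> F \<le> cofinite \<and>
     (\<forall>P. eventually P F \<or> eventually (\<lambda>x. \<not> P x) F)"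

text \<open>Representatives of elements of M^U: uniformly bounded sequences in M.\<close>
definition ultra_seq :: "('g, 'm) monoid_scheme \<Rightarrow> (nat \<Rightarrow> 'g \<Rightarrow> complex) set" where
  "ultra_seq G = {X. (\<forall>n. X n \<in> vnL G) \<and> (\<exists>C. \<forall>n. op_bound G (X n) C)}"

text \<open>equality in M^U: the 2-norm of the difference tends to 0 along F\<close>
definition ueq :: "('g, 'm) monoid_scheme \<Rightarrow> nat filter \<Rightarrow> (nat \<Rightarrow> 'g \<Rightarrow> complex) \<Rightarrow> (nat \<Rightarrow> 'g \<Rightarrow> complex) \<Rightarrow> bool" where
  "ueq G F X Y \<longleftrightarrow> ((\<lambda>n. norm2 G (\<lambda>g. X n g - Y n g)) \<longlongrightarrow> 0) F"

definition haarU :: "('g, 'm) monoid_scheme \<Rightarrow> nat filter \<Rightarrow> (nat \<Rightarrow> 'g \<Rightarrow> complex) set" where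
  "haarU G F = {W \<in> ultra_seq G.
      ueq G F (\<lambda>n. conv G (adjL G (W n)) (W n)) (\<lambda>n. unitL G) \<and>
      ueq G F (\<lambda>n. conv G (W n) (adjL G (W n))) (\<lambda>n. unitL G) \<and>
      (\<forall>k\<ge>1. ((\<lambda>n. traceL G (powL G (W n) k)) \<longlongrightarrow> 0) F)}"

definition commU :: "('g, 'm) monoid_scheme \<Rightarrow> nat filter \<Rightarrow> (nat \<Rightarrow> 'g \<Rightarrow> complex) \<Rightarrow> (nat \<Rightarrow> 'g \<Rightarrow> complex) \<Rightarrow> bool" where
  "commU G F X Y \<longleftrightarrow> ueq G F (\<lambda>n. conv G (X n) (Y n)) (\<lambda>n. conv G (Y n) (X n))"

definition haar_chain :: "('g, 'm) monoid_scheme \<Rightarrow> nat filter \<Rightarrow> nat \<Rightarrow> ('g \<Rightarrow> complex) \<Rightarrow> ('g \<Rightarrow> complex) \<Rightarrow> bool" where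
  "haar_chain G F k u v \<longleftrightarrow> (\<exists>W :: nat \<Rightarrow> nat \<Rightarrow> 'g \<Rightarrow> complex.
      W 0 = (\<lambda>n. u) \<and> W k = (\<lambda>n. v) \<and>
      (\<forall>i. 0 < i \<and> i < k \<longrightarrow> W i \<in> haarU G F) \<and>
      (\<forall>i<k. commU G F (W i) (W (Suc i))))"

definition pM :: "('g, 'm) monoid_scheme \<Rightarrow> nat filter \<Rightarrow> ('g \<Rightarrow> complex) \<Rightarrow> ('g \<Rightarrow> complex) \<Rightarrow> enat" where
  "pM G F u v = (if u = v then 0
      else if \<exists>k\<ge>1. haar_chain G F k u v
           then enat (LEAST k. k \<ge> 1 \<and> haar_chain G F k u v) else \<infinity>)"

text \<open>Generators 0,1,2,3,4 stand for u1, v1, v2, v3, u2; letter (i, b) is the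
 generator i (b = False) or its inverse (b = True).  i and j commute iff |i-j| = 1.\<close>

definition path_adj :: "nat \<Rightarrow> nat \<Rightarrow> bool" where
  "path_adj i j \<longleftrightarrow> i < 5 \<and> j < 5 \<and> (i = Suc j \<or> j = Suc i)"

inductive raag_step :: "(nat \<times> bool) list \<Rightarrow> (nat \<times> bool) list \<Rightarrow> bool" where
  cancel: "i < 5 \<Longrightarrow> raag_step (xs @ [(i, b), (i, \<not> b)] @ ys) (xs @ ys)"
| comm: "path_adj i j \<Longrightarrow> raag_step (xs @ [(i, b), (j, c)] @ ys) (xs @ [(j, c), (i, b)] @ ys)"

definition raag_cls :: "(nat \<times> bool) list \<Rightarrow> (nat \<times> bool) list set" where
  "raag_cls w = {w'. equivclp raag_step w w'}"

definition raag_words :: "(nat \<times> bool) list set" where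
  "raag_words = {w. \<forall>a\<in>set w. fst a < 5}"

definition raag :: "(nat \<times> bool) list set monoid" where
  "raag = \<lparr> carrier = raag_cls ` raag_words,
            mult = (\<lambda>A B. raag_cls ((SOME a. a \<in> A) @ (SOME b. b \<in> B))),
            one = raag_cls [] \<rparr>"

definition raag_gen :: "nat \<Rightarrow> (nat \<times> bool) list set" where
  "raag_gen i = raag_cls [(i, False)]"

end

theory Submission
  imports Defs
begin

text \<open>
The group splits over \<open>\<langle>v\<^sub>2\<rangle>\<close> as an amalgam of \<open>\<langle>u\<^sub>1, v\<^sub>1, v\<^sub>2\<rangle>\<close> and \<open>\<langle>v\<^sub>2, v\<^sub>3, u\<^sub>2\<rangle>\<close>. Let \<open>Q\<close> be
the set of elements whose path in the Bass--Serre tree starts on the \<open>u\<^sub>1\<close>-side, and \<open>B = \<langle>v\<^sub>2\<rangle>\<close>.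
Conjugation by powers of \<open>u\<^sub>1\<close> moves every nontrivial element into \<open>Q\<close>, so a trace zero \<open>x\<close> commuting
with \<open>u\<^sub>1\<close> lives asymptotically on \<open>Q\<close> and on \<open>Q\<^sup>-\<^sup>1\<close>; likewise a \<open>y\<close> commuting with \<open>u\<^sub>2\<close> lives on the
mirror image of \<open>Q\<close>, which is disjoint from \<open>Q\<close>.

The tree gives the Cotlar identity
\<open>(1\<^sub>Q(g\<^sup>-\<^sup>1) - 1\<^sub>Q(h)) (1\<^sub>Q(gh) - 1\<^sub>Q(g)) = - 1\<^sub>B(g) 1\<^sub>Q(h)\<close>. Summed against \<open>x\<close>, \<open>y\<close> and \<open>(xy)\<^sup>*\<close>, each
of its terms cuts off at most two of the three bounded factors, so it is controlled by 2-norms even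
though the cut-offs are unbounded operators. This forces \<open>xy\<close> to live on \<open>Q\<close>. By symmetry \<open>yx\<close> lives on
the mirror image. If \<open>xy = yx\<close> in the ultrapower, then \<open>xy = 0\<close>, which is absurd for unitaries.
\<close>

section \<open>Reduced words\<close>

text \<open>If \<open>x\<close> and \<open>y\<close> were supported exactly on the sets where they
  concentrate, concatenation would suffice: a route that ends on one side does not cancel against a
  route that starts on the other, so the product starts where its first factor starts. But the
  concentration holds only in 2-norm, and the truncated pieces lose their operator bounds, so
  products of truncation errors are not controlled. Conjugation by \<open>u_1\<close> has to move
  even the elements of the edge group. This works because \<open>u_1\<close> does not commute with
  \<open>v_2\<close>; the neighbour \<open>v_1\<close> does, and fixes them. The identity is the
  only element left behind, and it is removed by the vanishing trace of the first power. The lower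
  bound reduces to chains of length three, because both endpoints are Haar and commute with
  themselves, so a shorter chain can be padded. The upper bound is witnessed by the generators. The
  group is given by rewriting of words, so a normal form theorem is needed before routes make
  sense.\<close>

abbreviation adjs :: "nat \<Rightarrow> (nat \<times> bool) list \<Rightarrow> bool" where
  "adjs i q \<equiv> \<forall>a\<in>set q. path_adj i (fst a)"

abbreviation raag_eq :: "(nat \<times> bool) list \<Rightarrow> (nat \<times> bool) list \<Rightarrow> bool" (infix "\<bumpeq>" 50) where
  "u \<bumpeq> v \<equiv> equivclp raag_step u v"

lemma path_adj_sym: "path_adj i j \<longleftrightarrow> path_adj j i"
  by (auto simp: path_adj_def)

lemma path_adj_irrefl [simp]: "\<not> path_adj i i"
  by (auto simp: path_adj_def)

lemma raag_step_context: "raag_step u v \<Longrightarrow> raag_step (p @ u @ r) (p @ v @ r)"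
proof (induction rule: raag_step.induct)
  case (cancel i xs b ys)
  then show ?case using raag_step.cancel[of i "p @ xs" b "ys @ r"] by simp
next
  case (comm i j xs b c ys)
  then show ?case using raag_step.comm[of i j "p @ xs" b c "ys @ r"] by simp
qed

lemma raag_eq_context: "u \<bumpeq> v \<Longrightarrow> p @ u @ r \<bumpeq> p @ v @ r"
proof (induction rule: equivclp_induct)
  case (step y z)
  then have "raag_step (p @ y @ r) (p @ z @ r) \<or> raag_step (p @ z @ r) (p @ y @ r)"
    using raag_step_context by blast
  then show ?case using step.IH by (auto intro: equivclp_into_equivclp)
qed simp

lemma raag_eq_append: "u \<bumpeq> u' \<Longrightarrow> v \<bumpeq> v' \<Longrightarrow> u @ v \<bumpeq> u' @ v'"
  using raag_eq_context[of u u' "[]" v] raag_eq_context[of v v' u' "[]"]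
  by (auto intro: equivclp_trans)

lemma raag_eq_cancel: "i < 5 \<Longrightarrow> p @ [(i, b), (i, \<not> b)] @ r \<bumpeq> p @ r"
  by (intro r_into_equivclp raag_step.cancel)

lemma raag_eq_move: "adjs i q \<Longrightarrow> q @ [(i, b)] \<bumpeq> (i, b) # q"
proof (induction q)
  case (Cons a q)
  obtain j c where a: "a = (j, c)" by (cases a)
  have "a # (q @ [(i, b)]) \<bumpeq> a # (i, b) # q"
    using raag_eq_context[OF Cons.IH, of "[a]" "[]"] Cons.prems by simp
  also have "raag_step (a # (i, b) # q) ((i, b) # a # q)"
    using raag_step.comm[of j i "[]" c b q] Cons.prems a path_adj_sym[of i j] by simp
  then have "a # (i, b) # q \<bumpeq> (i, b) # a # q" by (rule r_into_equivclp)
  finally (equivclp_trans) show ?case by simp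
qed simp

lemma raag_eq_delete:
  assumes "adjs i q" "i < 5"
  shows "p @ (i, b) # q @ (i, \<not> b) # r \<bumpeq> p @ q @ r"
proof -
  have "(p @ [(i, b)]) @ (q @ [(i, \<not> b)]) @ r \<bumpeq> (p @ [(i, b)]) @ ((i, \<not> b) # q) @ r"
    by (intro raag_eq_context raag_eq_move assms)
  also have "p @ [(i, b), (i, \<not> b)] @ (q @ r) \<bumpeq> p @ q @ r"
    by (rule raag_eq_cancel) (rule assms)
  then have "(p @ [(i, b)]) @ ((i, \<not> b) # q) @ r \<bumpeq> p @ q @ r" by simp
  finally (equivclp_trans) show ?thesis by simp
qed

text \<open>A class may contain several reduced words, differing by commutations. No canonical one
  is chosen, so whatever is read off a reduced word must later be shown to depend on its class
  only.\<close>

definition red :: "(nat \<times> bool) list \<Rightarrow> bool" where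
  "red w \<longleftrightarrow> \<not> (\<exists>p i b q r. w = p @ (i, b) # q @ (i, \<not> b) # r \<and> adjs i q)"

lemma redI: "(\<And>p i b q r. w = p @ (i, b) # q @ (i, \<not> b) # r \<Longrightarrow> adjs i q \<Longrightarrow> False) \<Longrightarrow> red w"
  unfolding red_def by blast

lemma redD: "red w \<Longrightarrow> w = p @ (i, b) # q @ (i, \<not> b) # r \<Longrightarrow> adjs i q \<Longrightarrow> False"
  unfolding red_def by blast

lemma red_appendD: assumes "red (u @ v)" shows "red u" "red v"
proof -
  show "red u"
  proof (rule redI)
    fix p i b q r assume "u = p @ (i, b) # q @ (i, \<not> b) # r" "adjs i q"
    then show False using redD[OF assms, of p i b q "r @ v"] by simp
  qed
  show "red v"
  proof (rule redI)
    fix p i b q r assume "v = p @ (i, b) # q @ (i, \<not> b) # r" "adjs i q"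
    then show False using redD[OF assms, of "u @ p" i b q r] by simp
  qed
qed

text \<open>Neither reduced factor contains a cancelling pair, so the pair straddles the junction
  and the letters between its members split into a tail of \<open>u\<close> and a head of
  \<open>v\<close>.\<close>

lemma not_red_append:
  assumes "red u" "red v" "\<not> red (u @ v)"
  obtains p i b q q' r where "u = p @ (i, b) # q" "v = q' @ (i, \<not> b) # r" "adjs i (q @ q')"
proof -
  obtain p i b q r where w: "u @ v = p @ (i, b) # q @ (i, \<not> b) # r" and q: "adjs i q"
    using assms(3) by (auto simp: red_def)
  have "(u @ v) = (p @ (i, b) # q) @ (i, \<not> b) # r" using w by simp
  then obtain us where us: "u = (p @ (i, b) # q) @ us \<and> us @ v = (i, \<not> b) # r \<or>
      u @ us = p @ (i, b) # q \<and> v = us @ (i, \<not> b) # r"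
    using append_eq_append_conv2[THEN iffD1] by blast
  have L: "u @ us = p @ (i, b) # q \<and> v = us @ (i, \<not> b) # r"
  proof (cases us)
    case Nil
    then show ?thesis using us by auto
  next
    case (Cons a us')
    have False if "u = (p @ (i, b) # q) @ us" "us @ v = (i, \<not> b) # r"
    proof -
      have "u = p @ (i, b) # q @ (i, \<not> b) # us'" using that Cons by auto
      then show False using redD[OF assms(1)] q by blast
    qed
    then show ?thesis using us by blast
  qed
  then obtain vs where vs: "u = p @ vs \<and> vs @ us = (i, b) # q \<or> u @ vs = p \<and> us = vs @ (i, b) # q"
    using append_eq_append_conv2[THEN iffD1, of u us p "(i, b) # q"] by blast
  show thesis
  proof (cases vs)
    case Nil
    have "us = (i, b) # q" using vs Nil by auto
    then have "v = [] @ (i, b) # q @ (i, \<not> b) # r" using L by simp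
    then show thesis using redD[OF assms(2)] q by blast
  next
    case (Cons a vs')
    have False if "us = vs @ (i, b) # q"
    proof -
      have "v = vs @ (i, b) # q @ (i, \<not> b) # r" using that L by simp
      then show False using redD[OF assms(2)] q by blast
    qed
    then have "u = p @ (i, b) # vs'" "q = vs' @ us" using vs Cons by auto
    then show thesis using that[of p i b vs' us r] L q by auto
  qed
qed

text \<open>A cancelling pair created by the deletion would have its first member in
  \<open>p\<close> and its second in \<open>q\<close>. The second is adjacent to \<open>i\<close>,
  so the deleted letter never separated the pair.\<close>

lemma red_delete_last:
  assumes "red (p @ (i, b) # q)" "adjs i q"
  shows "red (p @ q)"
proof (rule ccontr)
  assume nr: "\<not> red (p @ q)"
  have "red p" "red ((i, b) # q)" using red_appendD[OF assms(1)] by auto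
  moreover have "red q" using red_appendD[of "[(i, b)]" q] calculation by simp
  ultimately obtain p' j c s s' r where *: "p = p' @ (j, c) # s" "q = s' @ (j, \<not> c) # r" "adjs j (s @ s')"
    using nr not_red_append by blast
  then have "path_adj j i" using assms(2) path_adj_sym[of i j] by auto
  then have "adjs j (s @ (i, b) # s')" using *(3) by auto
  moreover have "p @ (i, b) # q = p' @ (j, c) # (s @ (i, b) # s') @ (j, \<not> c) # r" using * by simp
  ultimately show False using redD[OF assms(1)] by blast
qed

abbreviation winv :: "(nat \<times> bool) list \<Rightarrow> (nat \<times> bool) list" where
  "winv w \<equiv> rev (map (\<lambda>a. (fst a, \<not> snd a)) w)"

lemma winv_winv: "winv (winv w) = w"
  by (simp add: rev_map comp_def)

lemma red_winv: assumes "red w" shows "red (winv w)"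
proof (rule redI)
  fix p i b q r
  assume "winv w = p @ (i, b) # q @ (i, \<not> b) # r" and q: "adjs i q"
  then have "winv (winv w) = winv (p @ (i, b) # q @ (i, \<not> b) # r)" by simp
  then have "w = winv r @ (i, b) # winv q @ (i, \<not> b) # winv p"
    by (simp only: winv_winv) simp
  then show False using redD[OF assms, of "winv r" i b "winv q" "winv p"] q by auto
qed

lemma red_delete_first:
  assumes "red (q @ (i, b) # r)" "adjs i q"
  shows "red (q @ r)"
proof -
  have "red (winv r @ (i, \<not> b) # winv q)" using red_winv[OF assms(1)] by simp
  then have "red (winv r @ winv q)" by (rule red_delete_last) (use assms(2) in auto)
  then have "red (winv (winv r @ winv q))" by (rule red_winv)
  then show ?thesis by (simp add: rev_map comp_def)
qed

lemma winv_left: "w \<in> raag_words \<Longrightarrow> winv w @ w \<bumpeq> []"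
proof (induction w)
  case (Cons a w)
  obtain i b where a: "a = (i, b)" by (cases a)
  have "winv w @ [(i, \<not> b), (i, \<not> \<not> b)] @ w \<bumpeq> winv w @ w"
    by (rule raag_eq_cancel) (use Cons.prems a in \<open>auto simp: raag_words_def\<close>)
  also have "winv w @ w \<bumpeq> []" using Cons by (auto simp: raag_words_def)
  finally (equivclp_trans) show ?case by (simp add: a)
qed simp

lemma winv_in [simp]: "w \<in> raag_words \<Longrightarrow> winv w \<in> raag_words"
  by (auto simp: raag_words_def)

lemma ex_red: "w \<in> raag_words \<Longrightarrow> \<exists>v. red v \<and> v \<in> raag_words \<and> v \<bumpeq> w"
proof (induction "length w" arbitrary: w rule: less_induct)
  case less
  show ?case
  proof (cases "red w")
    case False
    then obtain p i b q r where w: "w = p @ (i, b) # q @ (i, \<not> b) # r" "adjs i q"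
      by (auto simp: red_def)
    then obtain v where v: "red v" "v \<in> raag_words" "v \<bumpeq> p @ q @ r"
      using less.hyps[of "p @ q @ r"] less.prems by (auto simp: raag_words_def)
    moreover have "w \<bumpeq> p @ q @ r"
      unfolding w by (rule raag_eq_delete) (use w less.prems in \<open>auto simp: raag_words_def\<close>)
    ultimately show ?thesis by (meson equivclp_sym equivclp_trans)
  qed (use less.prems in auto)
qed

section \<open>Pilings and the normal form theorem\<close>

text \<open>In a piling (Crisp, Godelle, Wiest) the letter \<open>(i, b)\<close> puts the bead \<open>b\<close> on stack \<open>i\<close> and a blank
  bead on the stack of every generator that does not commute with \<open>i\<close>.\<close>

type_synonym piling = "nat \<Rightarrow> bool option list"

definition push :: "nat \<times> bool \<Rightarrow> piling \<Rightarrow> piling" where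
  "push a S = (\<lambda>j. if j = fst a then Some (snd a) # S j
                   else if path_adj (fst a) j then S j else None # S j)"

text \<open>\<open>tl\<close> removes the affected tops blindly. On the piling of a reduced word
  that shows a bead of \<open>i\<close>, these tops are exactly what one \<open>push\<close> has
  laid; this is \<open>red_topD\<close>.\<close>

definition pop :: "nat \<Rightarrow> piling \<Rightarrow> piling" where
  "pop i S = (\<lambda>j. if path_adj i j then S j else tl (S j))"

definition on_top :: "nat \<times> bool \<Rightarrow> piling \<Rightarrow> bool" where
  "on_top a S \<longleftrightarrow> (\<exists>t. S (fst a) = Some (snd a) # t)"

text \<open>Multiplication by a letter from the left, cancelling when possible. It is shown to
  respect the relations on pilings of reduced words, which is why \<open>state_pile\<close> is
  needed.\<close>

definition act :: "nat \<times> bool \<Rightarrow> piling \<Rightarrow> piling" where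
  "act a S = (if on_top (fst a, \<not> snd a) S then pop (fst a) S else push a S)"

definition pile :: "(nat \<times> bool) list \<Rightarrow> piling" where
  "pile w = foldr push w (\<lambda>_. [])"

lemma pile_simps [simp]: "pile [] = (\<lambda>_. [])" "pile (a # w) = push a (pile w)"
  by (auto simp: pile_def)

lemma pop_push [simp]: "pop i (push (i, b) S) = S"
  by (auto simp: pop_def push_def fun_eq_iff)

lemma on_top_push [simp]: "on_top a (push a S)"
  by (auto simp: on_top_def push_def)

lemma push_comm: "path_adj (fst a) (fst c) \<Longrightarrow> push a (push c S) = push c (push a S)"
  by (auto simp: push_def fun_eq_iff path_adj_sym)

text \<open>A letter in front covers stack \<open>i\<close> unless its generator is adjacent to
  \<open>i\<close>. The visible beads are therefore the letters that can be shuffled to the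
  front.\<close>

lemma on_top_pile_iff:
  "on_top (i, b) (pile w) \<longleftrightarrow> (\<exists>q r. w = q @ (i, b) # r \<and> adjs i q)"
proof (induction w)
  case (Cons a w)
  obtain j c where a: "a = (j, c)" by (cases a)
  show ?case
  proof (cases "j = i")
    case True
    then show ?thesis
      by (auto simp: on_top_def push_def a Cons_eq_append_conv intro: exI[of _ "[]"])
  next
    case False
    have *: "on_top (i, b) (push (j, c) (pile w)) \<longleftrightarrow> path_adj i j \<and> on_top (i, b) (pile w)"
      using False path_adj_sym[of i j] by (auto simp: on_top_def push_def)
    have "(\<exists>q r. a # w = q @ (i, b) # r \<and> adjs i q) \<longleftrightarrow>
        path_adj i j \<and> (\<exists>q r. w = q @ (i, b) # r \<and> adjs i q)" (is "?L \<longleftrightarrow> ?R")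
    proof
      assume ?L
      then obtain q r where "a # w = q @ (i, b) # r" "adjs i q" by blast
      then show ?R using False a by (cases q) auto
    next
      assume ?R
      then obtain q r where "path_adj i j" "w = q @ (i, b) # r" "adjs i q" by blast
      then show ?L using a by (intro exI[of _ "a # q"] exI[of _ r]) auto
    qed
    then show ?thesis using * a Cons.IH by simp
  qed
qed (auto simp: on_top_def)

lemma red_Cons_iff: "red w \<Longrightarrow> red ((i, b) # w) \<longleftrightarrow> \<not> on_top (i, \<not> b) (pile w)"
proof
  assume w: "red w" and "\<not> on_top (i, \<not> b) (pile w)"
  then have nt: "\<not> (\<exists>q r. w = q @ (i, \<not> b) # r \<and> adjs i q)" by (simp add: on_top_pile_iff)
  show "red ((i, b) # w)"
  proof (rule redI)
    fix p j c q r assume *: "(i, b) # w = p @ (j, c) # q @ (j, \<not> c) # r" "adjs j q"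
    show False
    proof (cases p)
      case Nil
      then show False using * nt by auto
    next
      case (Cons a p')
      then show False using * redD[OF w, of p'] by auto
    qed
  qed
next
  assume "red ((i, b) # w)"
  then show "\<not> on_top (i, \<not> b) (pile w)"
    using redD[of "(i, b) # w" "[]" i b] by (auto simp: on_top_pile_iff)
qed

lemma pile_move: "adjs i q \<Longrightarrow> pile (q @ (i, b) # r) = push (i, b) (pile (q @ r))"
proof (induction q)
  case (Cons a q)
  then show ?case using push_comm[of a "(i, b)"] path_adj_sym[of i] by simp
qed simp

text \<open>\<open>w'\<close> is \<open>w\<close> without its visible letter \<open>(i, b)\<close>.
  The inverse letter cannot become visible, as it would have cancelled against the deleted one;
  hence \<open>act\<close> puts the bead back by a push instead of popping again.\<close>

lemma red_topD:
  assumes w: "red w" and top: "on_top (i, b) (pile w)"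
  obtains w' where "red w'" "pile w = push (i, b) (pile w')" "\<not> on_top (i, \<not> b) (pile w')"
proof -
  obtain q r where qr: "w = q @ (i, b) # r" "adjs i q" using top by (auto simp: on_top_pile_iff)
  have r: "red (q @ r)" using red_delete_first w qr by blast
  have nt: "\<not> on_top (i, \<not> b) (pile (q @ r))"
  proof
    assume "on_top (i, \<not> b) (pile (q @ r))"
    then obtain q' r' where q': "q @ r = q' @ (i, \<not> b) # r'" "adjs i q'" by (auto simp: on_top_pile_iff)
    have iq: "(i, \<not> b) \<notin> set q" using qr(2) by auto
    obtain us where "q = q' @ us \<and> us @ r = (i, \<not> b) # r' \<or> q @ us = q' \<and> r = us @ (i, \<not> b) # r'"
      using append_eq_append_conv2[THEN iffD1, OF q'(1)] by blast
    then have "\<exists>us. q @ us = q' \<and> r = us @ (i, \<not> b) # r'"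
      using iq by (cases us) auto
    then obtain us where us: "q @ us = q'" "r = us @ (i, \<not> b) # r'" by blast
    then have "w = q @ (i, b) # us @ (i, \<not> b) # r'" "adjs i us" using qr q' by auto
    then show False using redD[OF w] by blast
  qed
  show thesis using that[OF r _ nt] qr pile_move by auto
qed

lemma red_act: assumes w: "red w" obtains w' where "red w'" "act a (pile w) = pile w'"
proof (cases "on_top (fst a, \<not> snd a) (pile w)")
  case True
  then obtain w' where "red w'" "pile w = push (fst a, \<not> snd a) (pile w')" by (rule red_topD[OF w])
  then show thesis using that True by (auto simp: act_def)
next
  case False
  then show thesis using that[of "a # w"] red_Cons_iff[OF w, of "fst a" "snd a"] by (simp add: act_def)
qed

lemma act_inverse: assumes w: "red w" shows "act (i, b) (act (i, \<not> b) (pile w)) = pile w"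
proof (cases "on_top (i, b) (pile w)")
  case True
  then obtain w' where "pile w = push (i, b) (pile w')" "\<not> on_top (i, \<not> b) (pile w')"
    by (rule red_topD[OF w])
  then show ?thesis using True by (simp add: act_def)
next
  case False
  then show ?thesis by (simp add: act_def)
qed

lemma on_top_adj:
  assumes "path_adj (fst a) j"
  shows "on_top (j, b) (push a S) \<longleftrightarrow> on_top (j, b) S" "on_top (j, b) (pop (fst a) S) \<longleftrightarrow> on_top (j, b) S"
  using assms by (auto simp: on_top_def push_def pop_def)

lemma act_comm:
  assumes w: "red w" and adj: "path_adj i j"
  shows "act (i, b) (act (j, c) (pile w)) = act (j, c) (act (i, b) (pile w))"
proof -
  \<comment> \<open>In the mixed cases, a stack touched by both letters gets a blank from the push
    and loses its top to the pop. The two orders agree because that top was a blank already.\<close>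
  have None: "\<exists>t. pile w k = None # t" if top: "on_top (l, d) (pile w)" and k: "k \<noteq> l" "\<not> path_adj l k" for l d k
  proof -
    obtain w' where "pile w = push (l, d) (pile w')" by (rule red_topD[OF w top])
    then show ?thesis using k by (auto simp: push_def)
  qed
  have adj': "path_adj j i" using adj path_adj_sym by blast
  have ij: "i \<noteq> j" using adj by auto
  note tops = on_top_adj[of "(i, _)" j, unfolded fst_conv, OF adj] on_top_adj[of "(j, _)" i, unfolded fst_conv, OF adj']
  show ?thesis
  proof (cases "on_top (i, \<not> b) (pile w)"; cases "on_top (j, \<not> c) (pile w)")
    assume "on_top (i, \<not> b) (pile w)" "on_top (j, \<not> c) (pile w)"
    then show ?thesis by (simp add: act_def tops) (auto simp: pop_def fun_eq_iff)
  next
    assume 1: "on_top (i, \<not> b) (pile w)" and 2: "\<not> on_top (j, \<not> c) (pile w)"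
    have "pop i (push (j, c) (pile w)) k = push (j, c) (pop i (pile w)) k" for k
      using None[OF 1, of k] adj adj' ij by (cases "k = i") (auto simp: pop_def push_def)
    then show ?thesis using 1 2 by (simp add: act_def tops fun_eq_iff)
  next
    assume 1: "\<not> on_top (i, \<not> b) (pile w)" and 2: "on_top (j, \<not> c) (pile w)"
    have "pop j (push (i, b) (pile w)) k = push (i, b) (pop j (pile w)) k" for k
      using None[OF 2, of k] adj adj' ij by (cases "k = j") (auto simp: pop_def push_def)
    then show ?thesis using 1 2 by (simp add: act_def tops fun_eq_iff)
  next
    assume "\<not> on_top (i, \<not> b) (pile w)" "\<not> on_top (j, \<not> c) (pile w)"
    then show ?thesis using adj push_comm[of "(i, b)" "(j, c)"] by (simp add: act_def tops)
  qed
qed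

definition state :: "(nat \<times> bool) list \<Rightarrow> piling" where
  "state w = foldr act w (\<lambda>_. [])"

lemma red_Nil [simp]: "red []"
  by (auto simp: red_def)

lemma state_pile: "\<exists>v. red v \<and> state w = pile v"
proof (induction w)
  case Nil
  show ?case by (rule exI[of _ "[]"]) (simp add: state_def)
next
  case (Cons a w)
  then obtain v where v: "red v" "state w = pile v" by blast
  obtain v' where "red v'" "act a (pile v) = pile v'" by (rule red_act[OF v(1)])
  then show ?case using v by (auto simp: state_def)
qed

lemma state_step: "raag_step u v \<Longrightarrow> state u = state v"
proof (induction rule: raag_step.induct)
  case (cancel i xs b ys)
  obtain v where v: "red v" "state ys = pile v" using state_pile by blast
  have "act (i, b) (act (i, \<not> b) (state ys)) = state ys" using act_inverse[OF v(1)] v(2) by simp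
  then show ?case by (simp add: state_def)
next
  case (comm i j xs b c ys)
  obtain v where v: "red v" "state ys = pile v" using state_pile by blast
  have "act (i, b) (act (j, c) (state ys)) = act (j, c) (act (i, b) (state ys))"
    using act_comm[OF v(1) comm] v(2) by simp
  then show ?case by (simp add: state_def)
qed

lemma state_cong: "u \<bumpeq> v \<Longrightarrow> state u = state v"
  by (induction rule: equivclp_induct) (auto dest: state_step)

lemma state_red: "red w \<Longrightarrow> state w = pile w"
proof (induction w)
  case (Cons a w)
  have w: "red w" using Cons.prems red_appendD(2)[of "[a]" w] by simp
  have "\<not> on_top (fst a, \<not> snd a) (pile w)"
    using red_Cons_iff[OF w, of "fst a" "snd a"] Cons.prems by simp
  then show ?case using Cons.IH[OF w] by (simp add: state_def act_def)
qed (simp add: state_def)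

text \<open>\<open>state\<close> is empty on the class of the empty word, while the first letter of
  a nonempty reduced word leaves a bead on its own stack. This weak normal form theorem suffices:
  \<open>sides_unique\<close> reduces the comparison of two reduced words to it.\<close>

lemma red_trivial: assumes "red w" "w \<bumpeq> []" shows "w = []"
proof (cases w)
  case (Cons a v)
  have "pile w = state []" using state_cong[OF assms(2)] state_red[OF assms(1)] by simp
  then have "push a (pile v) (fst a) = []" using Cons by (simp add: state_def)
  then show ?thesis by (simp add: push_def)
qed simp

section \<open>Routes in the Bass--Serre tree\<close>

text \<open>The generator 2 is skipped because it spans the edge group of the splitting; \<open>True\<close> stands for the
  vertex group containing the generators 0 and 1.\<close>

definition sides :: "(nat \<times> bool) list \<Rightarrow> bool list" where
  "sides w = map (\<lambda>a. fst a < 2) (filter (\<lambda>a. fst a \<noteq> 2) w)"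

lemma sides_simps [simp]:
  "sides [] = []" "sides (a # w) = (if fst a = 2 then sides w else (fst a < 2) # sides w)"
  "sides (u @ v) = sides u @ sides v"
  by (auto simp: sides_def)

lemma sides_winv [simp]: "sides (winv w) = rev (sides w)"
  by (induction w) auto

lemma sides_adjs: "adjs i q \<Longrightarrow> i \<noteq> 2 \<Longrightarrow> set (sides q) \<subseteq> {i < 2}"
  by (auto simp: sides_def path_adj_def)

text \<open>Generator 2 is not recorded, and all other neighbours of a generator other than 2 lie on
  its own side. So \<open>q\<close> contributes copies of one side only, among which the position of
  one more copy does not show. The signs \<open>b\<close> and \<open>c\<close> may differ because
  \<open>sides\<close> forgets them.\<close>

lemma sides_move: assumes "adjs i q" shows "sides ((i, b) # q) = sides (q @ [(i, c)])"
proof (cases "i = 2")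
  case False
  define s where "s = (i < 2)"
  have "s # l = l @ [s]" if "set l \<subseteq> {s}" for l using that by (induction l) auto
  from this[of "sides q"] show ?thesis using sides_adjs[OF assms False] False by (simp add: s_def)
qed simp

text \<open>The sides record an edge path in the Bass--Serre tree, and a geodesic triangle in a tree is a tripod.\<close>

lemma sides_tripod:
  assumes "red u" "red v" "u \<in> raag_words" "v \<in> raag_words"
  shows "\<exists>A C D w. red w \<and> w \<in> raag_words \<and> w \<bumpeq> u @ v \<and> sides u = A @ C \<and> sides v = rev C @ D \<and> sides w = A @ D"
  using assms
proof (induction "length u" arbitrary: u v rule: less_induct)
  case less
  show ?case
  proof (cases "red (u @ v)")
    case True
    then show ?thesis using less.prems
      by (intro exI[of _ "sides u"] exI[of _ "[]"] exI[of _ "sides v"] exI[of _ "u @ v"]) (auto simp: raag_words_def)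
  next
    case False
    obtain p i b q q' r where *: "u = p @ (i, b) # q" "v = q' @ (i, \<not> b) # r" "adjs i (q @ q')"
      by (rule not_red_append[OF less.prems(1,2) False])
    have i: "i < 5" using * less.prems(3) by (auto simp: raag_words_def)
    have "red (p @ q)" "red (q' @ r)"
      using * less.prems red_delete_last[of p i b q] red_delete_first[of q' i "\<not> b" r] by auto
    moreover have "p @ q \<in> raag_words" "q' @ r \<in> raag_words" using * less.prems by (auto simp: raag_words_def)
    ultimately obtain A C D w where IH: "red w" "w \<in> raag_words" "w \<bumpeq> (p @ q) @ (q' @ r)"
        "sides (p @ q) = A @ C" "sides (q' @ r) = rev C @ D" "sides w = A @ D"
      using less.hyps[of "p @ q" "q' @ r"] * by auto
    \<comment> \<open>\<open>t\<close> has at most one entry, so it is its own reversal. Moving the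
      cancelled letters to the junction lengthens the cancelled part \<open>C\<close> by
      \<open>t\<close>.\<close>
    define t where "t = sides [(i, b)]"
    have t: "rev t = t" by (simp add: t_def)
    have "sides u = sides p @ sides ((i, b) # q)" using * by (simp del: sides_simps(2))
    also have "\<dots> = sides p @ sides (q @ [(i, b)])" using sides_move[of q i b b] * by simp
    finally have u: "sides u = A @ C @ t" using IH by (simp add: t_def)
    have "sides v = sides (q' @ [(i, \<not> b)]) @ sides r" using * by simp
    also have "\<dots> = sides ((i, b) # q') @ sides r" using sides_move[of q' i b "\<not> b"] * by simp
    finally have v: "sides v = t @ rev C @ D" using IH by (simp add: t_def)
    have "u @ v \<bumpeq> p @ (q @ q') @ r"
      using raag_eq_delete[OF *(3) i, of p b r] * by simp
    then have w: "w \<bumpeq> u @ v" using IH by (metis append.assoc equivclp_sym equivclp_trans)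
    have "sides u = A @ (C @ t)" "sides v = rev (C @ t) @ D" using u v t by auto
    then show ?thesis using IH w by blast
  qed
qed

text \<open>In the tripod of \<open>winv u\<close> and \<open>v\<close> the product is trivial, so
  \<open>A\<close> and \<open>D\<close> are empty and the two routes are reversals of each
  other.\<close>

lemma sides_unique:
  assumes "red u" "red v" "u \<in> raag_words" "v \<in> raag_words" "u \<bumpeq> v"
  shows "sides u = sides v"
proof -
  obtain A C D w where w: "red w" "w \<bumpeq> winv u @ v" "sides (winv u) = A @ C" "sides v = rev C @ D" "sides w = A @ D"
    using sides_tripod[of "winv u" v] assms red_winv by auto
  have "winv u @ v \<bumpeq> winv u @ u"
    using assms(5) by (intro raag_eq_append) (auto intro: equivclp_sym)
  then have "w \<bumpeq> []" using w(2) winv_left[OF assms(3)] by (meson equivclp_trans)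
  then have "w = []" using red_trivial w by blast
  then have "sides v = rev (rev (sides u))" using w by simp
  then show ?thesis by simp
qed

section \<open>The group of classes of words\<close>

lemma raag_cls_eq_iff: "raag_cls u = raag_cls v \<longleftrightarrow> u \<bumpeq> v"
  unfolding raag_cls_def by (auto intro: equivclp_sym equivclp_trans)

lemma raag_cls_mult: "raag_cls u \<otimes>\<^bsub>raag\<^esub> raag_cls v = raag_cls (u @ v)"
proof -
  have "(SOME a. a \<in> raag_cls w) \<in> raag_cls w" for w
    by (rule someI[of _ w]) (simp add: raag_cls_def)
  then have "u @ v \<bumpeq> (SOME a. a \<in> raag_cls u) @ (SOME b. b \<in> raag_cls v)"
    by (intro raag_eq_append) (simp_all add: raag_cls_def)
  then show ?thesis by (simp add: raag_def raag_cls_eq_iff equivclp_sym)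
qed

lemma raag_one: "\<one>\<^bsub>raag\<^esub> = raag_cls []"
  by (simp add: raag_def)

lemma raag_carrier: "g \<in> carrier raag \<longleftrightarrow> (\<exists>w\<in>raag_words. g = raag_cls w)"
  by (auto simp: raag_def)

lemma raag_cls_carrier [simp]: "w \<in> raag_words \<Longrightarrow> raag_cls w \<in> carrier raag"
  by (auto simp: raag_carrier)

lemma raag_words_append [simp]: "u @ v \<in> raag_words \<longleftrightarrow> u \<in> raag_words \<and> v \<in> raag_words"
  by (auto simp: raag_words_def)

lemma group_raag: "group raag"
proof (rule groupI)
  show "\<one>\<^bsub>raag\<^esub> \<in> carrier raag" by (auto simp: raag_one raag_words_def)
next
  fix x assume "x \<in> carrier raag"
  then obtain w where w: "w \<in> raag_words" "x = raag_cls w" by (auto simp: raag_carrier)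
  then have "raag_cls (winv w) \<otimes>\<^bsub>raag\<^esub> x = \<one>\<^bsub>raag\<^esub>"
    by (simp add: raag_cls_mult raag_one raag_cls_eq_iff winv_left)
  then show "\<exists>y\<in>carrier raag. y \<otimes>\<^bsub>raag\<^esub> x = \<one>\<^bsub>raag\<^esub>" using w by auto
qed (auto simp: raag_carrier raag_cls_mult raag_one)

interpretation raag: group raag by (rule group_raag)

lemma raag_cls_inv: assumes "w \<in> raag_words" shows "inv\<^bsub>raag\<^esub> (raag_cls w) = raag_cls (winv w)"
  by (rule raag.inv_equality)
    (use assms in \<open>simp_all add: raag_cls_mult raag_one raag_cls_eq_iff winv_left\<close>)

lemma raag_gen_carrier [simp]: "i < 5 \<Longrightarrow> raag_gen i \<in> carrier raag"
  by (auto simp: raag_gen_def raag_words_def)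

lemma raag_gen_pow: "raag_gen i [^]\<^bsub>raag\<^esub> n = raag_cls (replicate n (i, False))"
proof (induction n)
  case (Suc n)
  then show ?case by (simp add: raag_gen_def raag_cls_mult replicate_append_same)
qed (simp add: raag_one)

lemma red_replicate: "red (replicate n (i, b))"
proof (rule redI)
  fix p j c q r assume *: "replicate n (i, b) = p @ (j, c) # q @ (j, \<not> c) # r"
  then have "(j, c) \<in> set (replicate n (i, b))" "(j, \<not> c) \<in> set (replicate n (i, b))" by simp_all
  then show False by (auto split: if_splits)
qed

lemma raag_gen_pow_neq_one: assumes "n \<ge> 1" shows "raag_gen i [^]\<^bsub>raag\<^esub> (n::nat) \<noteq> \<one>\<^bsub>raag\<^esub>"
  using red_trivial[OF red_replicate, of n i False] assms
  by (auto simp: raag_gen_pow raag_one raag_cls_eq_iff)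

lemma red_two: "i \<noteq> j \<Longrightarrow> red [(i, b), (j, c)]"
  by (auto simp: red_def Cons_eq_append_conv)

lemma raag_gen_inj: assumes "raag_gen i = raag_gen j" "i < 5" "j < 5" shows "i = j"
proof (rule ccontr)
  assume "i \<noteq> j"
  have "winv [(i, False)] @ [(i, False)] \<bumpeq> winv [(i, False)] @ [(j, False)]"
    using assms(1) by (intro raag_eq_append) (auto simp: raag_gen_def raag_cls_eq_iff)
  moreover have "winv [(i, False)] @ [(i, False)] \<bumpeq> []"
    by (rule winv_left) (use assms in \<open>auto simp: raag_words_def\<close>)
  ultimately have "[(i, True), (j, False)] \<bumpeq> []" by (simp, meson equivclp_sym equivclp_trans)
  then show False using red_trivial red_two[OF \<open>i \<noteq> j\<close>] by blast
qed

lemma raag_gen_commute: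
  assumes "path_adj i j"
  shows "raag_gen i \<otimes>\<^bsub>raag\<^esub> raag_gen j = raag_gen j \<otimes>\<^bsub>raag\<^esub> raag_gen i"
  using raag_step.comm[OF assms, of "[]" False False "[]"]
  by (auto simp: raag_gen_def raag_cls_mult raag_cls_eq_iff)

section \<open>Routes and branches of group elements\<close>

definition route :: "(nat \<times> bool) list set \<Rightarrow> bool list" where
  "route g = sides (SOME w. w \<in> raag_words \<and> red w \<and> g = raag_cls w)"

lemma route_cls: assumes "w \<in> raag_words" "red w" shows "route (raag_cls w) = sides w"
proof -
  let ?P = "\<lambda>v. v \<in> raag_words \<and> red v \<and> raag_cls w = raag_cls v"
  have "?P (SOME v. ?P v)" by (rule someI[of _ w]) (use assms in simp)
  then show ?thesis unfolding route_def
    using sides_unique[of "SOME v. ?P v" w] assms by (auto simp: raag_cls_eq_iff intro: equivclp_sym)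
qed

lemma raag_ex_red:
  assumes "g \<in> carrier raag"
  obtains w where "red w" "w \<in> raag_words" "g = raag_cls w"
proof -
  obtain v where v: "v \<in> raag_words" "g = raag_cls v" using assms by (auto simp: raag_carrier)
  obtain w where "red w" "w \<in> raag_words" "w \<bumpeq> v" using ex_red[OF v(1)] by blast
  then show thesis using that v by (auto simp: raag_cls_eq_iff intro: equivclp_sym)
qed

lemma route_tripod:
  assumes "g \<in> carrier raag" "h \<in> carrier raag"
  shows "\<exists>A C D. route g = A @ C \<and> route h = rev C @ D \<and> route (g \<otimes>\<^bsub>raag\<^esub> h) = A @ D"
proof -
  obtain u where u: "red u" "u \<in> raag_words" "g = raag_cls u" by (rule raag_ex_red[OF assms(1)])
  obtain v where v: "red v" "v \<in> raag_words" "h = raag_cls v" by (rule raag_ex_red[OF assms(2)])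
  obtain A C D w where w: "red w" "w \<in> raag_words" "w \<bumpeq> u @ v" "sides u = A @ C"
      "sides v = rev C @ D" "sides w = A @ D"
    using sides_tripod u v by meson
  have "g \<otimes>\<^bsub>raag\<^esub> h = raag_cls w"
    using u v w by (simp add: raag_cls_mult raag_cls_eq_iff equivclp_sym)
  then show ?thesis using u v w by (metis route_cls)
qed

lemma route_inv: assumes "g \<in> carrier raag" shows "route (inv\<^bsub>raag\<^esub> g) = rev (route g)"
proof -
  obtain u where u: "red u" "u \<in> raag_words" "g = raag_cls u" by (rule raag_ex_red[OF assms(1)])
  then show ?thesis using red_winv[of u] by (simp add: raag_cls_inv route_cls)
qed

text \<open>In the notation of the overview, \<open>branch True\<close> is \<open>Q\<close>,
  \<open>branch False\<close> is its mirror image and \<open>trunk\<close> is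
  \<open>B\<close>.\<close>

definition branch :: "bool \<Rightarrow> (nat \<times> bool) list set set" where
  "branch s = {g \<in> carrier raag. route g \<noteq> [] \<and> hd (route g) = s}"

definition trunk :: "(nat \<times> bool) list set set" where
  "trunk = {g \<in> carrier raag. route g = []}"

text \<open>In the tripod, a nonempty \<open>A\<close> is a common start of the routes of
  \<open>g\<close> and of the product, so the second factor vanishes. If \<open>A\<close> is empty
  and \<open>C\<close> is not, the inverse of \<open>g\<close> and \<open>h\<close> start alike, so
  the first factor vanishes. If both are empty, \<open>g\<close> is in the trunk and
  \<open>h\<close> and the product have the same route.\<close>

lemma branch_cotlar:
  assumes "g \<in> carrier raag" "h \<in> carrier raag"
  shows "(of_bool (inv\<^bsub>raag\<^esub> g \<in> branch s) - of_bool (h \<in> branch s)) *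
         (of_bool (g \<otimes>\<^bsub>raag\<^esub> h \<in> branch s) - of_bool (g \<in> branch s)) =
         - (of_bool (g \<in> trunk) * of_bool (h \<in> branch s) :: 'a :: ring_1)"
proof -
  obtain A C D where *: "route g = A @ C" "route h = rev C @ D" "route (g \<otimes>\<^bsub>raag\<^esub> h) = A @ D"
    using route_tripod[OF assms] by blast
  have i: "route (inv\<^bsub>raag\<^esub> g) = rev C @ rev A" using * assms by (simp add: route_inv)
  show ?thesis
    using assms by (cases A; cases C rule: rev_cases) (auto simp: branch_def trunk_def * i)
qed

lemma branch_disjoint: "branch True \<inter> branch False = {}"
  by (auto simp: branch_def)

text \<open>As \<open>g\<close> does not start on the side of \<open>i\<close>, the power on the
  left does not cancel. If the route of \<open>g\<close> is nonempty, the inverse power on the right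
  is too short to cancel back to the first entry. Otherwise \<open>g\<close> is a nontrivial power
  of generator 2, which blocks cancellation between the two powers.\<close>

lemma branch_conj:
  assumes i: "i = 0 \<or> i = 4" and n: "n \<ge> 1"
    and g: "g \<in> carrier raag" "g \<noteq> \<one>\<^bsub>raag\<^esub>" "g \<notin> branch (i < 2)"
  shows "raag_gen i [^]\<^bsub>raag\<^esub> (n::nat) \<otimes>\<^bsub>raag\<^esub> g \<otimes>\<^bsub>raag\<^esub> inv\<^bsub>raag\<^esub> (raag_gen i [^]\<^bsub>raag\<^esub> n) \<in> branch (i < 2)"
proof -
  define s where "s = (i < 2)"
  have i2: "i \<noteq> 2" "i < 5" "\<not> path_adj i 2" using i by (auto simp: path_adj_def)
  obtain w where w: "red w" "w \<in> raag_words" "g = raag_cls w" by (rule raag_ex_red[OF g(1)])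
  have wne: "w \<noteq> []" using g(2) w(3) by (auto simp: raag_one)
  have nb: "sides w = [] \<or> hd (sides w) \<noteq> s" using g w by (auto simp: branch_def route_cls s_def)
  define U V where "U = replicate n (i, False)" and "V = replicate n (i, True)"
  have U: "U \<in> raag_words" "V \<in> raag_words" "red U" "red V" "winv U = V"
    using i2 by (auto simp: U_def V_def raag_words_def red_replicate)
  have sU: "sides U = replicate n s" "sides V = replicate n s"
    using i2 unfolding U_def V_def s_def by (induction n) auto
  have Uw: "red (U @ w)"
  proof (rule ccontr)
    assume "\<not> red (U @ w)"
    then obtain p j b q q' r where *: "U = p @ (j, b) # q" "w = q' @ (j, \<not> b) # r" "adjs j (q @ q')"
      by (rule not_red_append[OF U(3) w(1)])
    have "(j, b) \<in> set U" using * by simp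
    then have j: "j = i" by (auto simp: U_def)
    have "sides w = sides (q' @ [(i, \<not> b)]) @ sides r" using * j by simp
    also have "sides (q' @ [(i, \<not> b)]) = sides ((i, b) # q')"
      using sides_move[of q' i b "\<not> b"] * j by simp
    finally show False using nb i2 by (simp add: s_def)
  qed
  have conj: "raag_gen i [^]\<^bsub>raag\<^esub> n \<otimes>\<^bsub>raag\<^esub> g \<otimes>\<^bsub>raag\<^esub> inv\<^bsub>raag\<^esub> (raag_gen i [^]\<^bsub>raag\<^esub> n)
      = raag_cls (U @ w) \<otimes>\<^bsub>raag\<^esub> raag_cls V"
    using U w by (simp add: raag_gen_pow raag_cls_inv raag_cls_mult flip: U_def)
  have rUw: "route (raag_cls (U @ w)) = replicate n s @ sides w" and rV: "route (raag_cls V) = replicate n s"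
    using Uw U w sU by (auto simp: route_cls)
  have "route (raag_cls (U @ w) \<otimes>\<^bsub>raag\<^esub> raag_cls V) \<noteq> [] \<and> hd (route (raag_cls (U @ w) \<otimes>\<^bsub>raag\<^esub> raag_cls V)) = s"
  proof (cases "sides w = []")
    case False
    obtain A C D where *: "route (raag_cls (U @ w)) = A @ C" "route (raag_cls V) = rev C @ D"
        "route (raag_cls (U @ w) \<otimes>\<^bsub>raag\<^esub> raag_cls V) = A @ D"
      using route_tripod[of "raag_cls (U @ w)" "raag_cls V"] U w by auto
    have "length A + length C = n + length (sides w)" "length C \<le> n"
      using arg_cong[OF *(1), of length] arg_cong[OF *(2), of length] rUw rV by simp_all
    then have "A \<noteq> []" using False by (cases A) auto
    moreover have "A @ C = s # replicate (n - 1) s @ sides w" using *(1) rUw n by (cases n) auto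
    then have "hd (A @ C) = s" by (simp only: list.sel)
    ultimately show ?thesis using * by simp
  next
    case True
    then have w2: "\<forall>a\<in>set w. fst a = 2" by (auto simp: sides_def filter_empty_conv)
    have "red ((U @ w) @ V)"
    proof (rule ccontr)
      assume "\<not> red ((U @ w) @ V)"
      then obtain p j b q q' r where *: "U @ w = p @ (j, b) # q" "V = q' @ (j, \<not> b) # r" "adjs j (q @ q')"
        by (rule not_red_append[OF Uw U(4)])
      have "(j, \<not> b) \<in> set V" using * by simp
      then have j: "j = i" by (auto simp: V_def)
      \<comment> \<open>A cancellation with \<open>V\<close> would have to start at the last letter
        of \<open>w\<close> or pass it. The generator of that letter is 2, neither equal nor
        adjacent to \<open>i\<close>.\<close>
      have "last w = last ((j, b) # q)" using arg_cong[OF *(1), of last] wne by simp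
      then have "fst (last ((j, b) # q)) = 2" using bspec[OF w2 last_in_set[OF wne]] by (simp only:)
      then have "fst (last q) = 2 \<and> q \<noteq> []" using j i2 by (auto split: if_splits)
      then show False using * j i2 by (metis UnI1 last_in_set set_append)
    qed
    then have "route (raag_cls ((U @ w) @ V)) = replicate n s @ replicate n s"
      using U w sU True by (simp add: route_cls)
    then show ?thesis using n by (cases n) (simp_all add: raag_cls_mult)
  qed
  then show ?thesis using U w unfolding conj s_def[symmetric] by (auto simp: branch_def)
qed

section \<open>The Hilbert space of square-summable functions\<close>

text \<open>Vectors are functions on the whole type, so that type class instances are available;
  support in the group is imposed separately by \<open>carr\<close>.\<close>

typedef 'a l2 = "{f :: 'a \<Rightarrow> complex. (\<lambda>x. (cmod (f x))\<^sup>2) summable_on UNIV}"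
  morphisms app Abs_l2
  by (rule exI[of _ "\<lambda>_. 0"]) simp

setup_lifting type_definition_l2

lemma app_summable: "(\<lambda>x. (cmod (app f x))\<^sup>2) summable_on A"
  by (rule summable_on_subset_banach[of _ UNIV]) (use app[of f] in simp_all)

lemma l2_eqI: "(\<And>x. app f x = app g x) \<Longrightarrow> f = g"
  unfolding app_inject[symmetric] by (rule ext)

lemma square_summable_mult:
  fixes f g :: "'a \<Rightarrow> complex"
  assumes "(\<lambda>x. (cmod (f x))\<^sup>2) summable_on A" "(\<lambda>x. (cmod (g x))\<^sup>2) summable_on A"
  shows "(\<lambda>x. norm (f x * g x)) summable_on A"
proof (rule Infinite_Sum.abs_summable_on_comparison_test')
  show "(\<lambda>x. (cmod (f x))\<^sup>2 + (cmod (g x))\<^sup>2) summable_on A"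
    by (intro summable_on_add assms)
  show "norm (f x * g x) \<le> (cmod (f x))\<^sup>2 + (cmod (g x))\<^sup>2" for x
  proof -
    have "2 * (cmod (f x) * cmod (g x)) \<le> (cmod (f x))\<^sup>2 + (cmod (g x))\<^sup>2"
      using sum_squares_bound[of "cmod (f x)" "cmod (g x)"] by simp
    moreover have "0 \<le> cmod (f x) * cmod (g x)" by simp
    ultimately show ?thesis by (simp only: norm_mult)
  qed
qed

lemma square_summable_add:
  fixes f g :: "'a \<Rightarrow> complex"
  assumes "(\<lambda>x. (cmod (f x))\<^sup>2) summable_on A" "(\<lambda>x. (cmod (g x))\<^sup>2) summable_on A"
  shows "(\<lambda>x. (cmod (f x + g x))\<^sup>2) summable_on A"
proof (rule summable_on_comparison_test)
  show "(\<lambda>x. 2 * (cmod (f x))\<^sup>2 + 2 * (cmod (g x))\<^sup>2) summable_on A"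
    by (intro summable_on_add summable_on_cmult_right assms)
  show "(cmod (f x + g x))\<^sup>2 \<le> 2 * (cmod (f x))\<^sup>2 + 2 * (cmod (g x))\<^sup>2" for x
  proof -
    have "(cmod (f x + g x))\<^sup>2 \<le> (cmod (f x) + cmod (g x))\<^sup>2"
      by (intro power_mono norm_triangle_ineq) simp
    also have "\<dots> \<le> 2 * (cmod (f x))\<^sup>2 + 2 * (cmod (g x))\<^sup>2"
      using sum_squares_bound[of "cmod (f x)" "cmod (g x)"] by (simp add: power2_sum)
    finally show ?thesis .
  qed
qed simp

lemma square_summable_cmult:
  fixes f :: "'a \<Rightarrow> complex"
  shows "(\<lambda>x. (cmod (f x))\<^sup>2) summable_on A \<Longrightarrow> (\<lambda>x. (cmod (c * f x))\<^sup>2) summable_on A"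
  by (simp add: norm_mult power_mult_distrib summable_on_cmult_right)

text \<open>The class instances supply real scalars only. Complex multiples are kept as a separate
  operation, and the inner product of the instance is the real part of the complex one.\<close>

lift_definition cscale :: "complex \<Rightarrow> 'a l2 \<Rightarrow> 'a l2" is "\<lambda>c f x. c * f x"
  by (simp add: square_summable_cmult)

instantiation l2 :: (type) real_vector
begin

lift_definition zero_l2 :: "'a l2" is "\<lambda>_. 0" by simp
lift_definition plus_l2 :: "'a l2 \<Rightarrow> 'a l2 \<Rightarrow> 'a l2" is "\<lambda>f g x. f x + g x"
  by (simp add: square_summable_add)
lift_definition uminus_l2 :: "'a l2 \<Rightarrow> 'a l2" is "\<lambda>f x. - f x" by simp
lift_definition minus_l2 :: "'a l2 \<Rightarrow> 'a l2 \<Rightarrow> 'a l2" is "\<lambda>f g x. f x - g x"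
proof -
  fix f g :: "'a \<Rightarrow> complex"
  assume "(\<lambda>x. (cmod (f x))\<^sup>2) summable_on UNIV" "(\<lambda>x. (cmod (g x))\<^sup>2) summable_on UNIV"
  then show "(\<lambda>x. (cmod (f x - g x))\<^sup>2) summable_on UNIV"
    using square_summable_add[of f UNIV "\<lambda>x. - g x"] by simp
qed
lift_definition scaleR_l2 :: "real \<Rightarrow> 'a l2 \<Rightarrow> 'a l2" is "\<lambda>c f x. of_real c * f x"
  by (simp add: square_summable_cmult)

instance
  by standard (transfer; auto simp: algebra_simps)+

end

lemma app_simps [simp]:
  "app 0 x = 0" "app (f + g) x = app f x + app g x" "app (- f) x = - app f x"
  "app (f - g) x = app f x - app g x" "app (r *\<^sub>R f) x = of_real r * app f x" "app (cscale c f) x = c * app f x"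
  by (transfer; simp)+

lemma app_sum: "app (sum f A) x = (\<Sum>a\<in>A. app (f a) x)"
  by (induction A rule: infinite_finite_induct) auto

lemma inner_summable: "(\<lambda>x. Re (app f x * cnj (app g x))) summable_on A"
proof -
  have "(\<lambda>x. norm (app f x * cnj (app g x))) summable_on A"
    by (rule square_summable_mult) (simp_all add: app_summable)
  then show ?thesis by (rule summable_on_Re[OF abs_summable_summable])
qed

instantiation l2 :: (type) real_inner
begin

definition inner_l2 :: "'a l2 \<Rightarrow> 'a l2 \<Rightarrow> real" where
  "inner_l2 f g = (\<Sum>\<^sub>\<infinity>x. Re (app f x * cnj (app g x)))"
definition norm_l2 :: "'a l2 \<Rightarrow> real" where "norm_l2 f = sqrt (inner f f)"
definition dist_l2 :: "'a l2 \<Rightarrow> 'a l2 \<Rightarrow> real" where "dist_l2 f g = norm (f - g)"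
definition sgn_l2 :: "'a l2 \<Rightarrow> 'a l2" where "sgn_l2 f = f /\<^sub>R norm f"
definition uniformity_l2 :: "('a l2 \<times> 'a l2) filter" where
  "uniformity_l2 = (INF e\<in>{0<..}. principal {(x, y). dist x y < e})"
definition open_l2 :: "'a l2 set \<Rightarrow> bool" where
  "open_l2 U \<longleftrightarrow> (\<forall>x\<in>U. eventually (\<lambda>(x', y). x' = x \<longrightarrow> y \<in> U) uniformity)"

instance
proof
  fix f g h :: "'a l2" and r :: real
  show "inner f g = inner g f" by (simp add: inner_l2_def mult.commute)
  show "inner (f + g) h = inner f h + inner g h"
    unfolding inner_l2_def app_simps distrib_right plus_complex.sel
    by (intro infsum_add inner_summable)
  show "inner (r *\<^sub>R f) g = r * inner f g"
    by (simp add: inner_l2_def mult.assoc infsum_cmult_right' flip: right_diff_distrib)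
  have sq: "Re (app f x * cnj (app f x)) = (cmod (app f x))\<^sup>2" for x
    unfolding cmod_power2 by (simp add: power2_eq_square)
  show "0 \<le> inner f f" unfolding inner_l2_def sq by (intro infsum_nonneg) simp
  show "inner f f = 0 \<longleftrightarrow> f = 0"
  proof
    assume "inner f f = 0"
    then have "(cmod (app f x))\<^sup>2 = 0" for x unfolding inner_l2_def sq
      using nonneg_infsum_le_0D[of "\<lambda>x. (cmod (app f x))\<^sup>2" UNIV x] app_summable[of f UNIV] by simp
    then show "f = 0" by (intro l2_eqI) simp
  qed (simp add: inner_l2_def)
qed (simp_all add: norm_l2_def dist_l2_def sgn_l2_def uniformity_l2_def open_l2_def)

end

lemma norm_l2_eq: "norm f = sqrt (\<Sum>\<^sub>\<infinity>x. (cmod (app f x))\<^sup>2)"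
  unfolding norm_l2_def inner_l2_def by (simp add: cmod_power2 flip: power2_eq_square)

lemma norm_l2_sq: "(norm f)\<^sup>2 = (\<Sum>\<^sub>\<infinity>x. (cmod (app f x))\<^sup>2)"
  unfolding norm_l2_eq by (simp add: infsum_nonneg)

lemma sum_le_norm_l2: "finite K \<Longrightarrow> (\<Sum>x\<in>K. (cmod (app f x))\<^sup>2) \<le> (norm f)\<^sup>2"
  unfolding norm_l2_sq by (intro finite_sum_le_infsum app_summable) auto

lemma cmod_app_le: "cmod (app f x) \<le> norm f"
proof -
  have "(cmod (app f x))\<^sup>2 \<le> (norm f)\<^sup>2" using sum_le_norm_l2[of "{x}" f] by simp
  then show ?thesis by (rule power2_le_imp_le) simp
qed

lemma square_summable_bound:
  fixes f :: "'a \<Rightarrow> complex"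
  assumes "\<And>K. finite K \<Longrightarrow> (\<Sum>x\<in>K. (cmod (f x))\<^sup>2) \<le> b\<^sup>2" "0 \<le> b"
  shows "\<exists>g. app g = f \<and> norm g \<le> b"
proof -
  have s: "(\<lambda>x. (cmod (f x))\<^sup>2) summable_on UNIV"
    by (rule nonneg_bounded_partial_sums_imp_summable_on[where C = "b\<^sup>2"]) (use assms in auto)
  then have g: "app (Abs_l2 f) = f" by (simp add: Abs_l2_inverse)
  have "(norm (Abs_l2 f))\<^sup>2 \<le> b\<^sup>2"
    unfolding norm_l2_sq g by (rule infsum_le_finite_sums) (use s assms in auto)
  then have "norm (Abs_l2 f) \<le> b" by (rule power2_le_imp_le) (rule assms)
  with g show ?thesis by blast
qed

instance l2 :: (type) complete_space
proof
  fix X :: "nat \<Rightarrow> 'a l2"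
  assume X: "Cauchy X"
  have "Cauchy (\<lambda>n. app (X n) x)" for x
  proof (rule metric_CauchyI)
    fix e :: real assume "0 < e"
    then obtain M where M: "\<And>m n. m \<ge> M \<Longrightarrow> n \<ge> M \<Longrightarrow> dist (X m) (X n) < e"
      using metric_CauchyD[OF X \<open>0 < e\<close>] by blast
    show "\<exists>M. \<forall>m\<ge>M. \<forall>n\<ge>M. dist (app (X m) x) (app (X n) x) < e"
    proof (intro exI allI impI)
      fix m n assume "m \<ge> M" "n \<ge> M"
      have "cmod (app (X m) x - app (X n) x) \<le> norm (X m - X n)" using cmod_app_le[of "X m - X n" x] by simp
      also have "\<dots> < e" using M[OF \<open>m \<ge> M\<close> \<open>n \<ge> M\<close>] by (simp add: dist_norm)
      finally show "dist (app (X m) x) (app (X n) x) < e" by (simp add: dist_norm)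
    qed
  qed
  then have "\<exists>l. (\<lambda>n. app (X n) x) \<longlonglongrightarrow> l" for x using Cauchy_convergent convergentD by blast
  then obtain f where f: "\<And>x. (\<lambda>n. app (X n) x) \<longlonglongrightarrow> f x" by metis
  have ex: "\<exists>g. app g = (\<lambda>x. app (X n) x - f x) \<and> norm g \<le> e"
    if e: "0 < e" and M: "\<And>m n. m \<ge> M \<Longrightarrow> n \<ge> M \<Longrightarrow> dist (X m) (X n) < e" and n: "n \<ge> M" for e M n
  proof (rule square_summable_bound)
    fix K :: "'a set" assume K: "finite K"
    \<comment> \<open>For fixed finite \<open>K\<close> the bound passes to the pointwise limit in
      \<open>m\<close>; being independent of \<open>K\<close>, it then bounds the whole
      norm.\<close>
    have lim: "(\<lambda>m. \<Sum>x\<in>K. (cmod (app (X n) x - app (X m) x))\<^sup>2) \<longlonglongrightarrow> (\<Sum>x\<in>K. (cmod (app (X n) x - f x))\<^sup>2)"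
      by (intro tendsto_intros f)
    have "(\<Sum>x\<in>K. (cmod (app (X n) x - app (X m) x))\<^sup>2) \<le> e\<^sup>2" if "m \<ge> M" for m
    proof -
      have "(\<Sum>x\<in>K. (cmod (app (X n) x - app (X m) x))\<^sup>2) \<le> (norm (X n - X m))\<^sup>2"
        using sum_le_norm_l2[OF K, of "X n - X m"] by simp
      also have "\<dots> \<le> e\<^sup>2" using M[OF n that] by (intro power_mono) (auto simp: dist_norm)
      finally show ?thesis .
    qed
    then show "(\<Sum>x\<in>K. (cmod (app (X n) x - f x))\<^sup>2) \<le> e\<^sup>2"
      by (intro tendsto_upperbound[OF lim]) (auto simp: eventually_sequentially)
  qed (use e in simp)
  obtain M where M: "\<And>m n. m \<ge> M \<Longrightarrow> n \<ge> M \<Longrightarrow> dist (X m) (X n) < 1" using metric_CauchyD[OF X zero_less_one] by blast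
  obtain g where g: "app g = (\<lambda>x. app (X M) x - f x)" using ex[OF zero_less_one M order_refl] by blast
  define F where "F = X M - g"
  have F: "app F = f" by (auto simp: F_def g)
  have "X \<longlonglongrightarrow> F"
  proof (rule metric_LIMSEQ_I)
    fix e :: real assume "0 < e"
    then have e2: "0 < e / 2" by simp
    then obtain M where M: "\<And>m n. m \<ge> M \<Longrightarrow> n \<ge> M \<Longrightarrow> dist (X m) (X n) < e / 2"
      using metric_CauchyD[OF X e2] by blast
    have "dist (X n) F < e" if n: "n \<ge> M" for n
    proof -
      obtain g where g: "app g = (\<lambda>x. app (X n) x - f x)" "norm g \<le> e / 2"
        using ex[OF e2 M n] by blast
      have "X n - F = g" by (rule l2_eqI) (simp add: g F)
      then show ?thesis using g(2) \<open>0 < e\<close> by (simp add: dist_norm)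
    qed
    then show "\<exists>M. \<forall>n\<ge>M. dist (X n) F < e" by blast
  qed
  then show "convergent X" by (rule convergentI)
qed

lemma inner_cscale: "inner (cscale c f) (cscale c g) = (cmod c)\<^sup>2 * inner f g"
proof -
  have "Re (app (cscale c f) x * cnj (app (cscale c g) x)) = (cmod c)\<^sup>2 * Re (app f x * cnj (app g x))" for x
    unfolding cmod_power2 by (simp add: algebra_simps power2_eq_square)
  then show ?thesis unfolding inner_l2_def by (simp add: infsum_cmult_right')
qed

lemma norm_cscale [simp]: "norm (cscale c f) = cmod c * norm f"
  by (simp add: norm_eq_sqrt_inner inner_cscale real_sqrt_mult)

lemma bounded_linear_cscale: "bounded_linear (cscale c)"
  by (rule bounded_linear_intro[where K = "cmod c"])
    (auto intro!: l2_eqI simp: algebra_simps)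

lift_definition restr :: "'a set \<Rightarrow> 'a l2 \<Rightarrow> 'a l2" is "\<lambda>E f x. if x \<in> E then f x else 0"
proof -
  fix E :: "'a set" and f :: "'a \<Rightarrow> complex"
  assume "(\<lambda>x. (cmod (f x))\<^sup>2) summable_on UNIV"
  then show "(\<lambda>x. (cmod (if x \<in> E then f x else 0))\<^sup>2) summable_on UNIV"
    by (rule summable_on_comparison_test) auto
qed

lemma app_restr [simp]: "app (restr E f) x = (if x \<in> E then app f x else 0)"
  by transfer simp

lemma norm_mono_app:
  assumes "\<And>x. cmod (app f x) \<le> cmod (app g x)" shows "norm f \<le> norm g"
  unfolding norm_l2_eq by (intro real_sqrt_le_mono infsum_mono app_summable power_mono assms) simp

lemma norm_restr_le: "norm (restr E f) \<le> norm f"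
  by (rule norm_mono_app) simp

lemma bounded_linear_restr: "bounded_linear (restr E)"
  by (rule bounded_linear_intro[where K = 1])
    (auto intro!: l2_eqI simp: norm_restr_le)

lemma restr_add_compl: "restr E f + restr (- E) f = f"
  by (rule l2_eqI) simp

lemma inner_restr: "inner f (restr E g) = inner (restr E f) g"
  unfolding inner_l2_def by (intro infsum_cong) simp

lemma inner_restr_self: "inner f (restr E f) = (norm (restr E f))\<^sup>2"
proof -
  have "inner f (restr E f) = inner f (restr E (restr E f))"
    by (rule arg_cong[of _ _ "inner f"]) (rule l2_eqI, simp)
  also have "\<dots> = inner (restr E f) (restr E f)" by (rule inner_restr)
  finally show ?thesis by (simp add: power2_norm_eq_inner)
qed

lemma restr_tendsto: "((\<lambda>A. restr A f) \<longlongrightarrow> f) (finite_subsets_at_top UNIV)"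
proof (rule tendstoI)
  fix e :: real assume e: "0 < e"
  have "((\<lambda>A. \<Sum>x\<in>A. (cmod (app f x))\<^sup>2) \<longlongrightarrow> (norm f)\<^sup>2) (finite_subsets_at_top UNIV)"
    using app_summable[of f UNIV] unfolding norm_l2_sq by (metis has_sum_def has_sum_infsum)
  then have "\<forall>\<^sub>F A in finite_subsets_at_top UNIV. dist (\<Sum>x\<in>A. (cmod (app f x))\<^sup>2) ((norm f)\<^sup>2) < e\<^sup>2"
    using e by (intro tendstoD) auto
  then show "\<forall>\<^sub>F A in finite_subsets_at_top UNIV. dist (restr A f) f < e"
    proof (rule eventually_elim2[OF _ eventually_finite_subsets_at_top_weakI])
    fix A :: "'a set" assume A: "dist (\<Sum>x\<in>A. (cmod (app f x))\<^sup>2) ((norm f)\<^sup>2) < e\<^sup>2" "finite A"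
    have "(norm (restr A f))\<^sup>2 = (\<Sum>\<^sub>\<infinity>x\<in>A. (cmod (app f x))\<^sup>2)"
      unfolding norm_l2_sq by (rule infsum_cong_neutral) auto
    then have fin: "(norm (restr A f))\<^sup>2 = (\<Sum>x\<in>A. (cmod (app f x))\<^sup>2)" using A(2) by simp
    have "(norm (restr A f - f))\<^sup>2 = (norm f)\<^sup>2 - (norm (restr A f))\<^sup>2"
      using inner_restr_self[of f A]
      by (simp add: power2_norm_eq_inner inner_diff_left inner_diff_right inner_commute)
    also have "\<dots> < e\<^sup>2" using A(1) fin by (simp add: dist_real_def)
    finally have "norm (restr A f - f) < e" using e by (intro power2_less_imp_less[of _ e]) auto
    then show "dist (restr A f) f < e" by (simp add: dist_norm)
  qed
qed

lift_definition single :: "'a \<Rightarrow> 'a l2" is "\<lambda>a x. if x = a then 1 else 0"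
proof -
  fix a :: 'a
  have "(\<lambda>x. (cmod (if x = a then 1 else 0))\<^sup>2) summable_on {a}" by simp
  then show "(\<lambda>x. (cmod (if x = a then 1 else 0))\<^sup>2) summable_on UNIV"
    by (rule summable_on_cong_neutral[THEN iffD1, rotated -1]) auto
qed

lemma app_single [simp]: "app (single a) x = (if x = a then 1 else 0)"
  by transfer simp

lemma restr_finite: "finite A \<Longrightarrow> restr A f = (\<Sum>a\<in>A. cscale (app f a) (single a))"
  by (rule l2_eqI) (simp add: app_sum sum.delta if_distrib cong: if_cong)

text \<open>The maps are only real-linear, so every complex multiple of a basis vector has to be
  tested. Finitely supported vectors are dense.\<close>

lemma l2_bounded_linear_eqI:
  assumes "bounded_linear T" "bounded_linear S" "\<And>c a. T (cscale c (single a)) = S (cscale c (single a))"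
  shows "T f = S f"
proof (rule tendsto_unique)
  interpret T: bounded_linear T by fact
  interpret S: bounded_linear S by fact
  show "((\<lambda>A. T (restr A f)) \<longlongrightarrow> T f) (finite_subsets_at_top UNIV)"
    by (rule T.tendsto restr_tendsto)+
  have "((\<lambda>A. S (restr A f)) \<longlongrightarrow> S f) (finite_subsets_at_top UNIV)"
    by (rule S.tendsto restr_tendsto)+
  moreover have "\<forall>\<^sub>F A in finite_subsets_at_top UNIV. S (restr A f) = T (restr A f)"
    by (rule eventually_finite_subsets_at_top_weakI) (simp add: restr_finite T.sum S.sum assms(3))
  ultimately show "((\<lambda>A. T (restr A f)) \<longlongrightarrow> S f) (finite_subsets_at_top UNIV)"
    by (rule Lim_transform_eventually)
qed (simp add: finite_subsets_at_top_neq_bot)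

text \<open>The projection theorem for a subspace that need not be closed. A sequence minimising the
  distance to \<open>v\<close> is Cauchy by the parallelogram law, because midpoints stay in
  \<open>S\<close>, and its limit is a nearest point of the closure.\<close>

lemma orthogonal_decomposition:
  fixes S :: "'b :: {real_inner, complete_space} set"
  assumes "subspace S"
  shows "\<exists>r. v - r \<in> closure S \<and> (\<forall>s\<in>S. inner r s = 0)"
proof -
  have S: "0 \<in> S" "\<And>x y. x \<in> S \<Longrightarrow> y \<in> S \<Longrightarrow> x + y \<in> S" "\<And>c x. x \<in> S \<Longrightarrow> c *\<^sub>R x \<in> S"
    using assms by (auto simp: subspace_def)
  define d where "d = Inf ((\<lambda>s. (norm (v - s))\<^sup>2) ` S)"
  have bdd: "bdd_below ((\<lambda>s. (norm (v - s))\<^sup>2) ` S)" by (rule bdd_belowI[of _ 0]) auto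
  have d: "d \<le> (norm (v - s))\<^sup>2" if "s \<in> S" for s
    unfolding d_def using that bdd by (intro cInf_lower) auto
  have "\<exists>s\<in>S. (norm (v - s))\<^sup>2 < d + 1 / real (Suc n)" for n
  proof -
    have "Inf ((\<lambda>s. (norm (v - s))\<^sup>2) ` S) < d + 1 / real (Suc n)" by (simp add: d_def[symmetric])
    then show ?thesis using S(1) bdd by (subst (asm) cInf_less_iff) auto
  qed
  then obtain s where s: "\<And>n. s n \<in> S" "\<And>n. (norm (v - s n))\<^sup>2 < d + 1 / real (Suc n)" by metis
  have para: "(norm (s m - s n))\<^sup>2 \<le> 2 * (1 / real (Suc m) + 1 / real (Suc n))" for m n
  proof -
    have "(norm (s m - s n))\<^sup>2 = 2 * (norm (v - s m))\<^sup>2 + 2 * (norm (v - s n))\<^sup>2 - 4 * (norm (v - (1/2) *\<^sub>R (s m + s n)))\<^sup>2"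
      by (simp add: power2_norm_eq_inner algebra_simps inner_commute)
    moreover have "d \<le> (norm (v - (1/2) *\<^sub>R (s m + s n)))\<^sup>2" using S s by (intro d) auto
    ultimately show ?thesis using s(2)[of m] s(2)[of n] by (simp add: algebra_simps)
  qed
  have "Cauchy s"
  proof (rule metric_CauchyI)
    fix e :: real assume e: "0 < e"
    obtain M where M: "1 / real (Suc M) < e\<^sup>2 / 4"
      using reals_Archimedean[of "e\<^sup>2 / 4"] e by (auto simp: inverse_eq_divide)
    have "dist (s m) (s n) < e" if "m \<ge> M" "n \<ge> M" for m n
    proof -
      have "1 / real (Suc m) \<le> 1 / real (Suc M)" "1 / real (Suc n) \<le> 1 / real (Suc M)"
        using that by (auto intro!: divide_left_mono)
      then have "(norm (s m - s n))\<^sup>2 < e\<^sup>2" using para[of m n] M by argo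
      then show ?thesis using e by (auto simp: dist_norm intro: power2_less_imp_less)
    qed
    then show "\<exists>M. \<forall>m\<ge>M. \<forall>n\<ge>M. dist (s m) (s n) < e" by blast
  qed
  then obtain l where l: "s \<longlonglongrightarrow> l" using Cauchy_convergent convergent_def by blast
  have lS: "l \<in> closure S" using l s(1) by (auto simp: closure_sequential)
  have min: "(norm (v - l))\<^sup>2 \<le> (norm (v - l - x))\<^sup>2" if x: "x \<in> S" for x
  proof -
    have "(\<lambda>n. (norm (v - s n))\<^sup>2 - 1 / real (Suc n)) \<longlonglongrightarrow> (norm (v - l))\<^sup>2 - 0"
      by (intro tendsto_intros l LIMSEQ_Suc lim_1_over_n)
    moreover have "(\<lambda>n. (norm (v - s n - x))\<^sup>2) \<longlonglongrightarrow> (norm (v - l - x))\<^sup>2"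
      by (intro tendsto_intros l)
    moreover have "(norm (v - s n))\<^sup>2 - 1 / real (Suc n) \<le> (norm (v - s n - x))\<^sup>2" for n
      using s(2)[of n] d[of "s n + x"] S(2)[OF s(1) x] by (simp add: algebra_simps)
    ultimately show ?thesis by (simp add: LIMSEQ_le)
  qed
  have "inner (v - l) x = 0" if x: "x \<in> S" for x
  proof (rule ccontr)
    assume nz: "inner (v - l) x \<noteq> 0"
    then have xx: "inner x x > 0" by auto
    define t where "t = inner (v - l) x / inner x x"
    have "(norm (v - l))\<^sup>2 \<le> (norm (v - l - t *\<^sub>R x))\<^sup>2" using x S(3) by (intro min) auto
    also have "\<dots> = (norm (v - l))\<^sup>2 - 2 * t * inner (v - l) x + t\<^sup>2 * inner x x"
      unfolding power2_norm_eq_inner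
      by (simp add: inner_diff_left inner_diff_right inner_commute power2_eq_square algebra_simps)
    also have "\<dots> = (norm (v - l))\<^sup>2 - (inner (v - l) x)\<^sup>2 / inner x x"
      using xx by (simp add: t_def power2_eq_square field_simps)
    finally have "(inner (v - l) x)\<^sup>2 / inner x x \<le> 0" by simp
    moreover have "(inner (v - l) x)\<^sup>2 / inner x x > 0" using nz xx by simp
    ultimately show False by simp
  qed
  then show ?thesis using lS by (intro exI[of _ "v - l"]) simp
qed

section \<open>Bounded convolution operators\<close>

lemma l2_reindex:
  assumes "inj_on \<phi> D" "\<And>x. x \<in> D \<Longrightarrow> cmod (h x) \<le> cmod (app f (\<phi> x))" "\<And>x. x \<notin> D \<Longrightarrow> h x = 0"
  shows "app (Abs_l2 h) = h \<and> norm (Abs_l2 h) \<le> norm f"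
proof -
  have "\<exists>g. app g = h \<and> norm g \<le> norm f"
  proof (rule square_summable_bound)
    fix K :: "'a set" assume K: "finite K"
    have "(\<Sum>x\<in>K. (cmod (h x))\<^sup>2) = (\<Sum>x\<in>K \<inter> D. (cmod (h x))\<^sup>2)"
      using K assms(3) by (intro sum.mono_neutral_right) auto
    also have "\<dots> \<le> (\<Sum>x\<in>K \<inter> D. (cmod (app f (\<phi> x)))\<^sup>2)"
      using assms(2) by (intro sum_mono power_mono) auto
    also have "\<dots> = (\<Sum>y\<in>\<phi> ` (K \<inter> D). (cmod (app f y))\<^sup>2)"
      using assms(1) by (subst sum.reindex) (auto intro: inj_on_subset)
    also have "\<dots> \<le> (norm f)\<^sup>2" using K by (intro sum_le_norm_l2) auto
    finally show "(\<Sum>x\<in>K. (cmod (h x))\<^sup>2) \<le> (norm f)\<^sup>2" .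
  qed simp
  then show ?thesis using app_inverse by metis
qed

lemma infsum_single:
  fixes f :: "'a \<Rightarrow> 'b :: {comm_monoid_add, t2_space}"
  assumes "\<And>x. x \<noteq> a \<Longrightarrow> x \<in> A \<Longrightarrow> f x = 0"
  shows "infsum f A = (if a \<in> A then f a else 0)"
proof -
  have "infsum f A = infsum f (A \<inter> {a})" using assms by (intro infsum_cong_neutral) auto
  then show ?thesis by (cases "a \<in> A") auto
qed

lemma cscale_one [simp]: "cscale 1 f = f"
  by (rule l2_eqI) simp

lemma app_zero: "app 0 = (\<lambda>_. 0)"
  by (rule ext) simp

definition cinner :: "'a l2 \<Rightarrow> 'a l2 \<Rightarrow> complex" where
  "cinner f g = (\<Sum>\<^sub>\<infinity>x. app f x * cnj (app g x))"

lemma cinner_summable: "(\<lambda>x. app f x * cnj (app g x)) summable_on A"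
  by (rule abs_summable_summable, rule square_summable_mult) (simp_all add: app_summable)

lemma Re_cinner: "Re (cinner f g) = inner f g"
  unfolding cinner_def inner_l2_def by (rule infsum_Re[OF cinner_summable, symmetric])

lemma cinner_cscale: "cinner (cscale c f) g = c * cinner f g"
  unfolding cinner_def by (simp add: mult.assoc infsum_cmult_right')

text \<open>The imaginary part is the real inner product with \<open>f\<close> rotated by
  \<open>- \<i>\<close>. Continuity of \<open>inner\<close> thus carries over to
  \<open>cinner\<close>.\<close>

lemma cinner_eq: "cinner f g = complex_of_real (inner f g) + \<i> * complex_of_real (inner (cscale (- \<i>) f) g)"
  by (rule complex_eqI) (simp_all add: cinner_cscale flip: Re_cinner)

lemma bounded_linear_cinner_left: "bounded_linear (\<lambda>f. cinner f g)"
  unfolding cinner_eq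
  by (intro bounded_linear_add bounded_linear_const_mult bounded_linear_compose[OF bounded_linear_of_real]
      bounded_linear_inner_left bounded_linear_compose[OF bounded_linear_inner_left bounded_linear_cscale])

lemma bounded_linear_cinner_right: "bounded_linear (\<lambda>g. cinner f g)"
  unfolding cinner_eq
  by (intro bounded_linear_add bounded_linear_const_mult bounded_linear_compose[OF bounded_linear_of_real]
      bounded_linear_inner_right)

section \<open>Translations, involution and pointwise continuity of convolution\<close>

context group
begin

definition ltr :: "'a \<Rightarrow> 'a l2 \<Rightarrow> 'a l2" where
  "ltr z f = Abs_l2 (\<lambda>x. if x \<in> carrier G then app f (inv z \<otimes> x) else 0)"

definition rtr :: "'a \<Rightarrow> 'a l2 \<Rightarrow> 'a l2" where
  "rtr z f = Abs_l2 (\<lambda>x. if x \<in> carrier G then app f (x \<otimes> inv z) else 0)"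

definition star :: "'a l2 \<Rightarrow> 'a l2" where
  "star f = Abs_l2 (adjL G (app f))"

lemma ltr: assumes "z \<in> carrier G"
  shows app_ltr: "app (ltr z f) = (\<lambda>x. if x \<in> carrier G then app f (inv z \<otimes> x) else 0)"
    and norm_ltr: "norm (ltr z f) \<le> norm f"
proof -
  have "inj_on (\<lambda>x. inv z \<otimes> x) (carrier G)" using assms by (intro inj_onI) auto
  from l2_reindex[OF this, of "\<lambda>x. if x \<in> carrier G then app f (inv z \<otimes> x) else 0" f]
  show "app (ltr z f) = (\<lambda>x. if x \<in> carrier G then app f (inv z \<otimes> x) else 0)" "norm (ltr z f) \<le> norm f"
    unfolding ltr_def by auto
qed

lemma rtr: assumes "z \<in> carrier G"
  shows app_rtr: "app (rtr z f) = (\<lambda>x. if x \<in> carrier G then app f (x \<otimes> inv z) else 0)"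
    and norm_rtr: "norm (rtr z f) \<le> norm f"
proof -
  have "inj_on (\<lambda>x. x \<otimes> inv z) (carrier G)" using assms by (intro inj_onI) auto
  from l2_reindex[OF this, of "\<lambda>x. if x \<in> carrier G then app f (x \<otimes> inv z) else 0" f]
  show "app (rtr z f) = (\<lambda>x. if x \<in> carrier G then app f (x \<otimes> inv z) else 0)" "norm (rtr z f) \<le> norm f"
    unfolding rtr_def by auto
qed

lemma star: shows app_star: "app (star f) = adjL G (app f)" and norm_star: "norm (star f) \<le> norm f"
proof -
  have "inj_on (\<lambda>x. inv x) (carrier G)" by (rule inj_onI) (metis inv_inv)
  from l2_reindex[OF this, of "adjL G (app f)" f]
  show "app (star f) = adjL G (app f)" "norm (star f) \<le> norm f"
    unfolding star_def by (auto simp: adjL_def)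
qed

lemma bounded_linear_ltr: "z \<in> carrier G \<Longrightarrow> bounded_linear (ltr z)"
  by (rule bounded_linear_intro[where K = 1]) (auto intro!: l2_eqI simp: app_ltr norm_ltr)

lemma bounded_linear_rtr: "z \<in> carrier G \<Longrightarrow> bounded_linear (rtr z)"
  by (rule bounded_linear_intro[where K = 1]) (auto intro!: l2_eqI simp: app_rtr norm_rtr)

lemma bounded_linear_star: "bounded_linear star"
  by (rule bounded_linear_intro[where K = 1]) (auto intro!: l2_eqI simp: app_star norm_star adjL_def)

lemma bij_inv: "bij_betw (\<lambda>x. inv x) (carrier G) (carrier G)"
  by (rule bij_betwI[of _ _ _ "\<lambda>x. inv x"]) auto

lemma mult_inv_cancel: "x \<in> carrier G \<Longrightarrow> y \<in> carrier G \<Longrightarrow> x \<otimes> (inv x \<otimes> y) = y"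
  by (simp flip: m_assoc)

lemma bij_mult_inv: "x \<in> carrier G \<Longrightarrow> bij_betw (\<lambda>z. x \<otimes> inv z) (carrier G) (carrier G)"
  by (rule bij_betwI[of _ _ _ "\<lambda>y. inv y \<otimes> x"]) (auto simp: inv_mult_group m_assoc mult_inv_cancel)

lemma bij_mult_right: "a \<in> carrier G \<Longrightarrow> bij_betw (\<lambda>z. z \<otimes> a) (carrier G) (carrier G)"
  by (rule bij_betwI[of _ _ _ "\<lambda>y. y \<otimes> inv a"]) (auto simp: m_assoc)

lemma conv_outside: "x \<notin> carrier G \<Longrightarrow> conv G f g x = 0"
  by (simp add: conv_def)

lemma conv_alt:
  assumes x: "x \<in> carrier G"
  shows "conv G f g x = (\<Sum>\<^sub>\<infinity>z\<in>carrier G. f (x \<otimes> inv z) * g z)"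
proof -
  have "conv G f g x = (\<Sum>\<^sub>\<infinity>y\<in>carrier G. f y * g (inv y \<otimes> x))" using x by (simp add: conv_def)
  also have "\<dots> = (\<Sum>\<^sub>\<infinity>z\<in>carrier G. f (x \<otimes> inv z) * g (inv (x \<otimes> inv z) \<otimes> x))"
    by (rule infsum_reindex_bij_betw[OF bij_mult_inv[OF x], symmetric])
  also have "\<dots> = (\<Sum>\<^sub>\<infinity>z\<in>carrier G. f (x \<otimes> inv z) * g z)"
    using x by (intro infsum_cong) (simp add: inv_mult_group m_assoc)
  finally show ?thesis .
qed

lemma conv_cong:
  "(\<And>x. x \<in> carrier G \<Longrightarrow> f x = f' x) \<Longrightarrow> (\<And>x. x \<in> carrier G \<Longrightarrow> g x = g' x) \<Longrightarrow> conv G f g = conv G f' g'"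
  unfolding conv_def by (intro ext if_cong infsum_cong refl) auto

text \<open>Each value of a convolution is an inner product, hence continuous in either argument,
  even though the convolution of two square-summable functions need not be square-summable.\<close>

lemma conv_cinner:
  assumes x: "x \<in> carrier G"
  shows "conv G (app f) (app g) x = cinner f (ltr x (star g))"
proof -
  have "conv G (app f) (app g) x = (\<Sum>\<^sub>\<infinity>y\<in>carrier G. app f y * app g (inv y \<otimes> x))"
    using x by (simp add: conv_def)
  also have "\<dots> = cinner f (ltr x (star g))"
    unfolding cinner_def using x
    by (intro infsum_cong_neutral) (auto simp: app_ltr app_star adjL_def inv_mult_group)
  finally show ?thesis .
qed

lemma bounded_linear_conv_left: "bounded_linear (\<lambda>f. conv G (app f) (app g) x)"
proof (cases "x \<in> carrier G")
  case True
  then show ?thesis by (simp add: conv_cinner bounded_linear_cinner_left)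
next
  case False
  then show ?thesis by (simp add: conv_outside bounded_linear_zero)
qed

lemma bounded_linear_conv_right: "bounded_linear (\<lambda>g. conv G (app f) (app g) x)"
proof (cases "x \<in> carrier G")
  case True
  then show ?thesis
    by (simp add: conv_cinner bounded_linear_compose[OF bounded_linear_cinner_right
          bounded_linear_compose[OF bounded_linear_ltr bounded_linear_star]])
next
  case False
  then show ?thesis by (simp add: conv_outside bounded_linear_zero)
qed

lemma conv_single_right:
  "conv G (app u) (app (cscale c (single z))) = (if z \<in> carrier G then app (cscale c (rtr z u)) else (\<lambda>_. 0))"
proof
  fix x
  show "conv G (app u) (app (cscale c (single z))) x =
      (if z \<in> carrier G then app (cscale c (rtr z u)) else (\<lambda>_. 0)) x"
  proof (cases "x \<in> carrier G")
    case True
    have "conv G (app u) (app (cscale c (single z))) x =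
        (if z \<in> carrier G then app u (x \<otimes> inv z) * app (cscale c (single z)) z else 0)"
      unfolding conv_alt[OF True] by (rule infsum_single) simp
    then show ?thesis using True by (simp add: app_rtr)
  qed (simp add: conv_outside app_rtr)
qed

lemma conv_single_left:
  "conv G (app (cscale c (single z))) (app v) = (if z \<in> carrier G then app (cscale c (ltr z v)) else (\<lambda>_. 0))"
proof
  fix x
  show "conv G (app (cscale c (single z))) (app v) x =
      (if z \<in> carrier G then app (cscale c (ltr z v)) else (\<lambda>_. 0)) x"
  proof (cases "x \<in> carrier G")
    case True
    then have "conv G (app (cscale c (single z))) (app v) x =
        (\<Sum>\<^sub>\<infinity>y\<in>carrier G. app (cscale c (single z)) y * app v (inv y \<otimes> x))" by (simp add: conv_def)
    also have "\<dots> = (if z \<in> carrier G then app (cscale c (single z)) z * app v (inv z \<otimes> x) else 0)"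
      by (rule infsum_single) simp
    finally show ?thesis using True by (simp add: app_ltr)
  qed (simp add: conv_outside app_ltr)
qed

lemma conv_finite_right:
  assumes "finite A" "A \<subseteq> carrier G"
  shows "conv G (app u) (app (restr A f)) = app (\<Sum>z\<in>A. cscale (app f z) (rtr z u))"
proof
  fix x
  interpret bounded_linear "\<lambda>g. conv G (app u) (app g) x" by (rule bounded_linear_conv_right)
  show "conv G (app u) (app (restr A f)) x = app (\<Sum>z\<in>A. cscale (app f z) (rtr z u)) x"
    unfolding restr_finite[OF assms(1)] sum app_sum using assms(2)
    by (intro sum.cong refl) (simp add: conv_single_right subset_iff)
qed

lemma conv_finite_left:
  assumes "finite A" "A \<subseteq> carrier G"
  shows "conv G (app (restr A f)) (app v) = app (\<Sum>z\<in>A. cscale (app f z) (ltr z v))"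
proof
  fix x
  interpret bounded_linear "\<lambda>g. conv G (app g) (app v) x" by (rule bounded_linear_conv_left)
  show "conv G (app (restr A f)) (app v) x = app (\<Sum>z\<in>A. cscale (app f z) (ltr z v)) x"
    unfolding restr_finite[OF assms(1)] sum app_sum using assms(2)
    by (intro sum.cong refl) (simp add: conv_single_left subset_iff)
qed

section \<open>Left and right bounded vectors\<close>

abbreviation carr :: "'a l2 \<Rightarrow> bool" where
  "carr f \<equiv> \<forall>x. x \<notin> carrier G \<longrightarrow> app f x = 0"

lemma norm2_app: "carr f \<Longrightarrow> norm2 G (app f) = norm f"
  unfolding norm2_def norm_l2_eq by (intro arg_cong[of _ _ sqrt] infsum_cong_neutral) auto

lemma ell2_app: "carr f \<Longrightarrow> app f \<in> ell2 G"
  by (auto simp: ell2_def app_summable)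

lemma ell2E: assumes "f \<in> ell2 G" obtains g where "app g = f" "carr g"
proof -
  have "(\<lambda>x. (cmod (f x))\<^sup>2) summable_on UNIV"
    by (rule summable_on_cong_neutral[THEN iffD1, of _ "carrier G" "\<lambda>x. (cmod (f x))\<^sup>2"])
      (use assms in \<open>auto simp: ell2_def\<close>)
  then have "app (Abs_l2 f) = f" by (simp add: Abs_l2_inverse)
  then show thesis using that assms by (auto simp: ell2_def)
qed

definition lb :: "'a l2 \<Rightarrow> real \<Rightarrow> bool" where
  "lb u C \<longleftrightarrow> 0 \<le> C \<and> (\<forall>f. \<exists>h. app h = conv G (app u) (app f) \<and> norm h \<le> C * norm f)"

definition rb :: "'a l2 \<Rightarrow> real \<Rightarrow> bool" where
  "rb v C \<longleftrightarrow> 0 \<le> C \<and> (\<forall>f. \<exists>h. app h = conv G (app f) (app v) \<and> norm h \<le> C * norm f)"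

text \<open>Meaningful only if the convolution is square-summable, which a left bounded first factor
  or a right bounded second factor guarantees.\<close>

definition cv :: "'a l2 \<Rightarrow> 'a l2 \<Rightarrow> 'a l2" where
  "cv f g = Abs_l2 (conv G (app f) (app g))"

lemma cv_eq: "app h = conv G (app f) (app g) \<Longrightarrow> cv f g = h"
  unfolding cv_def by (metis app_inverse)

lemma lb_app: "lb u C \<Longrightarrow> app (cv u f) = conv G (app u) (app f)"
  unfolding lb_def using cv_eq by metis

lemma lb_norm: "lb u C \<Longrightarrow> norm (cv u f) \<le> C * norm f"
  unfolding lb_def using cv_eq by metis

lemma rb_app: "rb v C \<Longrightarrow> app (cv f v) = conv G (app f) (app v)"
  unfolding rb_def using cv_eq by metis

lemma rb_norm: "rb v C \<Longrightarrow> norm (cv f v) \<le> C * norm f"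
  unfolding rb_def using cv_eq by metis

lemma lb_bounded_linear: assumes "lb u C" shows "bounded_linear (cv u)"
proof (rule bounded_linear_intro[where K = C])
  fix f g and r :: real
  interpret B: bounded_linear "\<lambda>g. conv G (app u) (app g) x" for x by (rule bounded_linear_conv_right)
  show "cv u (f + g) = cv u f + cv u g" by (rule l2_eqI) (simp add: lb_app[OF assms] B.add)
  show "cv u (r *\<^sub>R f) = r *\<^sub>R cv u f"
    by (rule l2_eqI) (simp add: lb_app[OF assms] B.scaleR scaleR_conv_of_real del: app_simps(5), simp add: lb_app[OF assms])
  show "norm (cv u f) \<le> norm f * C" using lb_norm[OF assms, of f] by (simp add: mult.commute)
qed

lemma rb_bounded_linear: assumes "rb v C" shows "bounded_linear (\<lambda>f. cv f v)"
proof (rule bounded_linear_intro[where K = C])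
  fix f g and r :: real
  interpret B: bounded_linear "\<lambda>g. conv G (app g) (app v) x" for x by (rule bounded_linear_conv_left)
  show "cv (f + g) v = cv f v + cv g v" by (rule l2_eqI) (simp add: rb_app[OF assms] B.add)
  show "cv (r *\<^sub>R f) v = r *\<^sub>R cv f v"
    by (rule l2_eqI) (simp add: rb_app[OF assms] B.scaleR scaleR_conv_of_real del: app_simps(5), simp add: rb_app[OF assms])
  show "norm (cv f v) \<le> norm f * C" using rb_norm[OF assms, of f] by (simp add: mult.commute)
qed

lemma lb_carr: "lb u C \<Longrightarrow> carr (cv u f)"
  by (simp add: lb_app conv_outside)

text \<open>Fatou's lemma extends the bound from finitely supported vectors to all of \<open>\<ell>\<^sup>2\<close>.\<close>

lemma lbI:
  assumes C: "0 \<le> C"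
    and bound: "\<And>A f. finite A \<Longrightarrow> A \<subseteq> carrier G \<Longrightarrow> norm (\<Sum>z\<in>A. cscale (app f z) (rtr z u)) \<le> C * norm (restr A f)"
  shows "lb u C"
  unfolding lb_def
proof (intro conjI allI C square_summable_bound)
  fix f and K :: "'a set" assume K: "finite K"
  define f' where "f' = restr (carrier G) f"
  have f': "conv G (app u) (app f) = conv G (app u) (app f')"
    by (rule conv_cong) (auto simp: f'_def)
  have lim: "((\<lambda>A. \<Sum>x\<in>K. (cmod (conv G (app u) (app (restr A f')) x))\<^sup>2) \<longlongrightarrow>
      (\<Sum>x\<in>K. (cmod (conv G (app u) (app f') x))\<^sup>2)) (finite_subsets_at_top UNIV)"
    by (intro tendsto_intros bounded_linear.tendsto[OF bounded_linear_conv_right] restr_tendsto)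
  have "(\<Sum>x\<in>K. (cmod (conv G (app u) (app (restr A f')) x))\<^sup>2) \<le> (C * norm f)\<^sup>2" if A: "finite A" for A
  proof -
    have r: "restr A f' = restr (A \<inter> carrier G) f" by (rule l2_eqI) (auto simp: f'_def)
    let ?h = "\<Sum>z\<in>A \<inter> carrier G. cscale (app f z) (rtr z u)"
    have "(\<Sum>x\<in>K. (cmod (conv G (app u) (app (restr A f')) x))\<^sup>2) \<le> (norm ?h)\<^sup>2"
      unfolding r using A K by (subst conv_finite_right) (auto intro: sum_le_norm_l2)
    also have "norm ?h \<le> C * norm (restr (A \<inter> carrier G) f)" using A by (intro bound) auto
    then have "norm ?h \<le> C * norm f"
      using mult_left_mono[OF norm_restr_le C] by (rule order_trans)
    then have "(norm ?h)\<^sup>2 \<le> (C * norm f)\<^sup>2" by (intro power_mono) auto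
    finally show ?thesis .
  qed
  then have "(\<Sum>x\<in>K. (cmod (conv G (app u) (app f') x))\<^sup>2) \<le> (C * norm f)\<^sup>2"
    by (intro tendsto_upperbound[OF lim] eventually_finite_subsets_at_top_weakI) auto
  then show "(\<Sum>x\<in>K. (cmod (conv G (app u) (app f) x))\<^sup>2) \<le> (C * norm f)\<^sup>2" by (simp only: f')
qed (use C in simp)

lemma carr_rtr_sum: "A \<subseteq> carrier G \<Longrightarrow> carr (\<Sum>z\<in>A. cscale (c z) (rtr z u))"
  by (auto simp: app_sum app_rtr subset_iff intro!: sum.neutral)

lemma op_bound_lb:
  assumes "op_bound G (app u) C"
  shows "lb u (max 0 C)"
proof (rule lbI)
  fix A f assume A: "finite A" "A \<subseteq> carrier G"
  have "fin_supp G (app (restr A f))"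
    unfolding fin_supp_def using A by (auto intro: finite_subset[of _ A])
  then have "norm2 G (conv G (app u) (app (restr A f))) \<le> C * norm2 G (app (restr A f))"
    using assms by (simp add: op_bound_def)
  also have "norm2 G (app (restr A f)) = norm (restr A f)" using A by (intro norm2_app) auto
  also have "norm2 G (conv G (app u) (app (restr A f))) = norm (\<Sum>z\<in>A. cscale (app f z) (rtr z u))"
    unfolding conv_finite_right[OF A] by (intro norm2_app carr_rtr_sum A)
  finally have "norm (\<Sum>z\<in>A. cscale (app f z) (rtr z u)) \<le> C * norm (restr A f)" .
  also have "\<dots> \<le> max 0 C * norm (restr A f)" by (intro mult_right_mono) auto
  finally show "norm (\<Sum>z\<in>A. cscale (app f z) (rtr z u)) \<le> max 0 C * norm (restr A f)" .
qed simp

lemma lb_op_bound: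
  assumes "lb u C"
  shows "op_bound G (app u) C"
  unfolding op_bound_def
proof (intro allI impI)
  fix f assume f: "fin_supp G f"
  then have "(\<lambda>x. (cmod (f x))\<^sup>2) summable_on carrier G"
    by (intro finite_nonzero_values_imp_summable_on) (auto simp: fin_supp_def elim: finite_subset[rotated])
  then have "f \<in> ell2 G" using f by (auto simp: ell2_def fin_supp_def)
  then obtain g where g: "app g = f" "carr g" by (rule ell2E)
  show "norm2 G (conv G (app u) f) \<le> C * norm2 G f"
    using lb_norm[OF assms, of g] norm2_app[OF lb_carr[OF assms], of g] norm2_app[OF g(2)]
    by (simp add: lb_app[OF assms] flip: g(1))
qed

lemma vnLE:
  assumes "f \<in> vnL G" "op_bound G f C"
  obtains u where "app u = f" "carr u" "lb u (max 0 C)"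
proof -
  have "f \<in> ell2 G" using assms by (simp add: vnL_def)
  then obtain u where "app u = f" "carr u" by (rule ell2E)
  then show thesis using that assms op_bound_lb by blast
qed

lemma adjL_conv: "adjL G (conv G f g) = conv G (adjL G g) (adjL G f)"
proof
  fix x
  show "adjL G (conv G f g) x = conv G (adjL G g) (adjL G f) x"
  proof (cases "x \<in> carrier G")
    case x: True
    have "adjL G (conv G f g) x = cnj (\<Sum>\<^sub>\<infinity>z\<in>carrier G. f (inv x \<otimes> inv z) * g z)"
      using x by (simp add: adjL_def conv_alt)
    also have "\<dots> = (\<Sum>\<^sub>\<infinity>z\<in>carrier G. cnj (f (inv x \<otimes> inv z) * g z))" by (rule infsum_cnj[symmetric])
    also have "\<dots> = (\<Sum>\<^sub>\<infinity>y\<in>carrier G. cnj (f (inv x \<otimes> inv (inv y)) * g (inv y)))"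
      by (rule infsum_reindex_bij_betw[OF bij_inv, symmetric])
    also have "\<dots> = (\<Sum>\<^sub>\<infinity>y\<in>carrier G. adjL G g y * adjL G f (inv y \<otimes> x))"
      using x by (intro infsum_cong) (simp add: adjL_def inv_mult_group)
    finally show ?thesis using x by (simp add: conv_def)
  qed (simp add: adjL_def conv_def)
qed

lemma lb_star_rb: assumes "lb (star v) C" shows "rb v C"
  unfolding rb_def
proof (intro conjI allI)
  show "0 \<le> C" using assms by (simp add: lb_def)
  fix f
  have "conv G (app f) (app v) = conv G (adjL G (adjL G (app f))) (adjL G (adjL G (app v)))"
    by (rule conv_cong) (auto simp: adjL_def)
  also have "\<dots> = app (star (cv (star v) (star f)))"
    by (simp add: app_star lb_app[OF assms] adjL_conv)
  finally have "app (star (cv (star v) (star f))) = conv G (app f) (app v)" ..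
  moreover have "norm (star (cv (star v) (star f))) \<le> C * norm f"
  proof -
    have "norm (star (cv (star v) (star f))) \<le> C * norm (star f)"
      using norm_star lb_norm[OF assms] by (rule order_trans)
    also have "\<dots> \<le> C * norm f" using norm_star \<open>0 \<le> C\<close> by (intro mult_left_mono)
    finally show ?thesis .
  qed
  ultimately show "\<exists>h. app h = conv G (app f) (app v) \<and> norm h \<le> C * norm f" by blast
qed

lemma inner_rtr_star:
  assumes z: "z \<in> carrier G" and u: "lb u C"
  shows "inner (cscale c (rtr z (star u))) f = inner (cscale c (single z)) (cv u f)"
proof -
  have s: "cinner (single z) h = cnj (app h z)" for h
    unfolding cinner_def by (subst infsum_single[of z]) auto
  have "cnj (app (cv u f) z) = cnj (\<Sum>\<^sub>\<infinity>x\<in>carrier G. app u (z \<otimes> inv x) * app f x)"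
    using z by (simp add: lb_app[OF u] conv_alt)
  also have "\<dots> = (\<Sum>\<^sub>\<infinity>x\<in>carrier G. cnj (app u (z \<otimes> inv x) * app f x))" by (rule infsum_cnj[symmetric])
  also have "\<dots> = cinner (rtr z (star u)) f"
    unfolding cinner_def using z
    by (intro infsum_cong_neutral) (auto simp: app_rtr app_star adjL_def inv_mult_group)
  finally show ?thesis unfolding Re_cinner[symmetric] cinner_cscale s by simp
qed

lemma inner_ltr_star:
  assumes z: "z \<in> carrier G" and w: "lb w C"
  shows "inner (cscale c (ltr z q)) w = inner (cscale c (single z)) (cv w (star q))"
proof -
  have s: "cinner (single z) h = cnj (app h z)" for h
    unfolding cinner_def by (subst infsum_single[of z]) auto
  have "cnj (app (cv w (star q)) z) = cnj (\<Sum>\<^sub>\<infinity>y\<in>carrier G. app w y * app (star q) (inv y \<otimes> z))"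
    using z by (simp add: lb_app[OF w] conv_def)
  also have "\<dots> = (\<Sum>\<^sub>\<infinity>y\<in>carrier G. cnj (app w y * app (star q) (inv y \<otimes> z)))" by (rule infsum_cnj[symmetric])
  also have "\<dots> = cinner (ltr z q) w"
    unfolding cinner_def using z
    by (intro infsum_cong_neutral) (auto simp: app_ltr app_star adjL_def inv_mult_group)
  finally show ?thesis unfolding Re_cinner[symmetric] cinner_cscale s by simp
qed

text \<open>Left convolution by \<open>star u\<close> is the adjoint of left convolution by
  \<open>u\<close>. Pairing a finite combination \<open>?h\<close> of translates with itself gives
  its squared norm as an inner product with \<open>cv u ?h\<close>; Cauchy-Schwarz and division by
  the norm of \<open>?h\<close> yield the same bound \<open>C\<close>.\<close>

lemma lb_star: assumes u: "lb u C" shows "lb (star u) C"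
proof (rule lbI)
  show C: "0 \<le> C" using u by (simp add: lb_def)
  fix A f assume A: "finite A" "A \<subseteq> carrier G"
  let ?h = "\<Sum>z\<in>A. cscale (app f z) (rtr z (star u))"
  have "(norm ?h)\<^sup>2 = (\<Sum>z\<in>A. inner (cscale (app f z) (rtr z (star u))) ?h)"
    by (simp add: power2_norm_eq_inner inner_sum_left)
  also have "\<dots> = (\<Sum>z\<in>A. inner (cscale (app f z) (single z)) (cv u ?h))"
    using A by (intro sum.cong refl inner_rtr_star[OF _ u]) auto
  also have "\<dots> = inner (restr A f) (cv u ?h)" by (simp add: restr_finite[OF A(1)] inner_sum_left)
  also have "\<dots> \<le> norm (restr A f) * (C * norm ?h)"
    by (rule order_trans[OF norm_cauchy_schwarz mult_left_mono[OF lb_norm[OF u]]]) simp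
  finally have "norm ?h * norm ?h \<le> (C * norm (restr A f)) * norm ?h" by (simp add: power2_eq_square algebra_simps)
  then show "norm ?h \<le> C * norm (restr A f)"
    using C by (cases "norm ?h = 0") (auto simp: mult_le_cancel_right)
qed

lemma lb_rb: "lb u C \<Longrightarrow> rb u C"
  by (intro lb_star_rb lb_star)

lemma ltr_rtr_conv:
  assumes a: "a \<in> carrier G"
  shows "conv G (app u) (app (ltr a v)) = conv G (app (rtr a u)) (app v)"
proof
  fix x
  show "conv G (app u) (app (ltr a v)) x = conv G (app (rtr a u)) (app v) x"
  proof (cases "x \<in> carrier G")
    case x: True
    have "conv G (app (rtr a u)) (app v) x = (\<Sum>\<^sub>\<infinity>y\<in>carrier G. app u (y \<otimes> inv a) * app v (inv y \<otimes> x))"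
      using x a by (auto simp: conv_def app_rtr intro!: infsum_cong)
    also have "\<dots> = (\<Sum>\<^sub>\<infinity>y\<in>carrier G. app u ((y \<otimes> a) \<otimes> inv a) * app v (inv (y \<otimes> a) \<otimes> x))"
      by (rule infsum_reindex_bij_betw[OF bij_mult_right[OF a], symmetric])
    also have "\<dots> = conv G (app u) (app (ltr a v)) x"
      using x a by (auto simp: conv_def app_ltr inv_mult_group m_assoc intro!: infsum_cong)
    finally show ?thesis ..
  qed (simp add: conv_def)
qed

text \<open>Left and right convolution commute on point masses, and both are bounded. The middle
  factor may be any square-summable vector.\<close>

lemma cv_assoc:
  assumes u: "lb u C" and v: "rb v D"
  shows "cv u (cv f v) = cv (cv u f) v"
proof (rule l2_bounded_linear_eqI[of "\<lambda>f. cv u (cv f v)" "\<lambda>f. cv (cv u f) v"])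
  show "bounded_linear (\<lambda>f. cv u (cv f v))"
    by (rule bounded_linear_compose[OF lb_bounded_linear[OF u] rb_bounded_linear[OF v]])
  show "bounded_linear (\<lambda>f. cv (cv u f) v)"
    by (rule bounded_linear_compose[OF rb_bounded_linear[OF v] lb_bounded_linear[OF u]])
  fix c and a :: 'a
  interpret L: bounded_linear "cv u" by (rule lb_bounded_linear[OF u])
  interpret R: bounded_linear "\<lambda>f. cv f v" by (rule rb_bounded_linear[OF v])
  have cs: "cv u (cscale c f) = cscale c (cv u f)" "cv (cscale c f) v = cscale c (cv f v)" for f
    by (rule l2_eqI; simp add: lb_app[OF u] rb_app[OF v] conv_def mult.assoc mult.left_commute infsum_cmult_right')+
  have "cv u (cv (single a) v) = cv (cv u (single a)) v"
  proof (cases "a \<in> carrier G")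
    case True
    then have "cv u (single a) = rtr a u" "cv (single a) v = ltr a v"
      using conv_single_right[of u 1 a] conv_single_left[of 1 a v] by (auto intro!: cv_eq)
    then show ?thesis using ltr_rtr_conv[OF True, of u v] by (simp add: cv_def)
  next
    case False
    then have "cv u (single a) = 0" "cv (single a) v = 0"
      using conv_single_right[of u 1 a] conv_single_left[of 1 a v] by (auto intro!: cv_eq simp: app_zero)
    then show ?thesis by (simp add: L.zero R.zero)
  qed
  then show "cv u (cv (cscale c (single a)) v) = cv (cv u (cscale c (single a))) v"
    by (simp only: cs)
qed

text \<open>Left convolution commutes with right translation, so a combination of translates of
  \<open>cv u v\<close> is \<open>cv u\<close> of the same combination for \<open>v\<close>.\<close>

lemma lb_cv: assumes u: "lb u C" and v: "lb v D" shows "lb (cv u v) (C * D)"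
proof (rule lbI)
  show "0 \<le> C * D" using u v by (simp add: lb_def)
  fix A f assume A: "finite A" "A \<subseteq> carrier G"
  interpret L: bounded_linear "cv u" by (rule lb_bounded_linear[OF u])
  have 1: "cscale c (rtr z (cv u v)) = cv u (cscale c (rtr z v))" if "z \<in> carrier G" for c z
  proof (rule l2_eqI)
    fix x
    show "app (cscale c (rtr z (cv u v))) x = app (cv u (cscale c (rtr z v))) x"
      using that by (auto simp: lb_app[OF u] app_rtr conv_def m_assoc mult.left_commute
          simp flip: infsum_cmult_right' intro!: infsum_cong)
  qed
  have "(\<Sum>z\<in>A. cscale (app f z) (rtr z (cv u v))) = cv u (\<Sum>z\<in>A. cscale (app f z) (rtr z v))"
    unfolding L.sum using A 1 by (intro sum.cong) auto
  also have "(\<Sum>z\<in>A. cscale (app f z) (rtr z v)) = cv v (restr A f)"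
    using conv_finite_right[OF A, of v f] by (intro cv_eq[symmetric]) simp
  finally have "norm (\<Sum>z\<in>A. cscale (app f z) (rtr z (cv u v))) \<le> C * norm (cv v (restr A f))"
    using lb_norm[OF u] by simp
  also have "\<dots> \<le> C * (D * norm (restr A f))"
    using lb_norm[OF v] u by (intro mult_left_mono) (auto simp: lb_def)
  finally show "norm (\<Sum>z\<in>A. cscale (app f z) (rtr z (cv u v))) \<le> C * D * norm (restr A f)" by simp
qed

lemma norm_single [simp]: "norm (single a) = 1"
proof -
  have "(norm (single a))\<^sup>2 = 1" unfolding norm_l2_sq by (subst infsum_single[of a]) auto
  then show ?thesis using norm_ge_zero[of "single a"] by (auto simp: power2_eq_1_iff)
qed

lemma cv_one_right: "carr u \<Longrightarrow> cv u (single \<one>) = u"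
proof (rule cv_eq)
  assume "carr u"
  then have "app u x = app (rtr \<one> u) x" for x by (cases "x \<in> carrier G") (auto simp: app_rtr)
  then show "app u = conv G (app u) (app (single \<one>))"
    using conv_single_right[of u 1 \<one>] by (simp add: fun_eq_iff)
qed

lemma lb_norm_le: "lb u C \<Longrightarrow> carr u \<Longrightarrow> norm u \<le> C"
  using lb_norm[of u C "single \<one>"] by (simp add: cv_one_right)

end

section \<open>Products of asymptotically supported elements\<close>

lemma cinner_cscale_right: "cinner f (cscale c g) = cnj c * cinner f g"
  unfolding cinner_def by (simp add: mult.left_commute infsum_cmult_right')

lemma cscale_cscale: "cscale c (cscale d f) = cscale (c * d) f"
  by (rule l2_eqI) simp

context group
begin

lemma cinner_ltr:
  assumes z: "z \<in> carrier G"
  shows "cinner (ltr z f) g = cinner f (ltr (inv z) g)"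
proof -
  have "cinner (ltr z f) g = (\<Sum>\<^sub>\<infinity>x\<in>carrier G. app f (inv z \<otimes> x) * cnj (app g x))"
    unfolding cinner_def using z by (intro infsum_cong_neutral) (auto simp: app_ltr)
  also have "\<dots> = (\<Sum>\<^sub>\<infinity>x\<in>carrier G. app f (inv z \<otimes> x) * cnj (app g (z \<otimes> (inv z \<otimes> x))))"
    using z by (intro infsum_cong) (simp add: mult_inv_cancel)
  also have "\<dots> = (\<Sum>\<^sub>\<infinity>y\<in>carrier G. app f y * cnj (app g (z \<otimes> y)))"
    by (rule infsum_reindex_bij_betw[where g = "\<lambda>x. inv z \<otimes> x"], rule bij_betwI[of _ _ _ "\<lambda>x. z \<otimes> x"])
      (use z in \<open>auto simp flip: m_assoc\<close>)
  also have "\<dots> = cinner f (ltr (inv z) g)"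
    unfolding cinner_def using z by (intro infsum_cong_neutral) (auto simp: app_ltr)
  finally show ?thesis .
qed

lemma ltr_ltr: "a \<in> carrier G \<Longrightarrow> b \<in> carrier G \<Longrightarrow> ltr a (ltr b f) = ltr (a \<otimes> b) f"
  by (rule l2_eqI) (simp add: app_ltr inv_mult_group m_assoc)

lemma ltr_cscale: "a \<in> carrier G \<Longrightarrow> ltr a (cscale c f) = cscale c (ltr a f)"
  by (rule l2_eqI) (simp add: app_ltr)

lemma ltr_single:
  assumes "a \<in> carrier G" "w \<in> carrier G" shows "ltr a (single w) = single (a \<otimes> w)"
proof (rule l2_eqI)
  fix x
  have "inv a \<otimes> x = w \<longleftrightarrow> x = a \<otimes> w" if "x \<in> carrier G"
    using that assms by (auto simp: mult_inv_cancel simp flip: m_assoc)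
  then show "app (ltr a (single w)) x = app (single (a \<otimes> w)) x" using assms by (auto simp: app_ltr)
qed

lemma ltr_zero: "a \<in> carrier G \<Longrightarrow> ltr a 0 = 0"
  by (rule l2_eqI) (simp add: app_ltr)

lemma ltr_one: "carr f \<Longrightarrow> ltr \<one> f = f"
  by (rule l2_eqI) (simp add: app_ltr)

lemma cv_single_left: "z \<in> carrier G \<Longrightarrow> cv (cscale c (single z)) v = cscale c (ltr z v)"
  by (rule cv_eq) (simp add: conv_single_left)

text \<open>Right convolution by \<open>q\<close> may be unbounded, so it is treated as a densely
  defined operator through its graph. Convergence in the graph norm controls a vector and its
  convolution with \<open>q\<close> at once.\<close>

definition conv_graph :: "'a l2 \<Rightarrow> ('a l2 \<times> 'a l2) set" where
  "conv_graph q = {(f, h). fin_supp G (app f) \<and> app h = conv G (app f) (app q)}"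

lemma subspace_conv_graph: "subspace (conv_graph q)"
proof (rule subspaceI)
  interpret B: bounded_linear "\<lambda>f. conv G (app f) (app q) x" for x by (rule bounded_linear_conv_left)
  show "0 \<in> conv_graph q"
    using B.zero by (simp add: conv_graph_def zero_prod_def fin_supp_def fun_eq_iff)
  fix s assume s: "s \<in> conv_graph q"
  then obtain f h where fh: "s = (f, h)" "fin_supp G (app f)" "app h = conv G (app f) (app q)"
    by (auto simp: conv_graph_def)
  show "s + t \<in> conv_graph q" if t: "t \<in> conv_graph q" for t
  proof -
    obtain f' h' where fh': "t = (f', h')" "fin_supp G (app f')" "app h' = conv G (app f') (app q)"
      using t by (auto simp: conv_graph_def)
    have "x \<in> carrier G" if "app (f + f') x \<noteq> 0" for x
      using fh fh' that by (cases "app f x = 0") (auto simp: fin_supp_def)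
    then have "fin_supp G (app (f + f'))"
      using fh fh' unfolding fin_supp_def
      by (intro conjI finite_subset[of "{x. app (f + f') x \<noteq> 0}" "{x. app f x \<noteq> 0} \<union> {x. app f' x \<noteq> 0}"]) auto
    then show ?thesis using fh fh' by (simp add: conv_graph_def B.add fun_eq_iff)
  qed
  show "r *\<^sub>R s \<in> conv_graph q" for r
  proof -
    have "fin_supp G (app (r *\<^sub>R f))"
      using fh unfolding fin_supp_def
      by (intro conjI finite_subset[of "{x. app (r *\<^sub>R f) x \<noteq> 0}" "{x. app f x \<noteq> 0}"]) auto
    then show ?thesis using fh B.scaleR[of r f] by (simp add: conv_graph_def fun_eq_iff scaleR_conv_of_real)
  qed
qed

text \<open>The projection onto the orthogonal complement of the graph commutes with left translations,
  so its matrix entries are convolutions from the right and commute with convolution by \<open>X\<close> from the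
  left; it annihilates \<open>(1, q)\<close> and therefore \<open>(X, X q)\<close>.\<close>

lemma closure_conv_graph:
  assumes X: "carr X" "lb X C" and q: "carr q"
  shows "(X, cv X q) \<in> closure (conv_graph q)"
proof -
  define U where "U z c v = (cscale c (ltr z (fst v)), cscale c (ltr z (snd v)))" for z c and v :: "'a l2 \<times> 'a l2"
  \<comment> \<open>\<open>span\<close> is real, so all complex multiples of the translates of
    \<open>(single \<one>, q)\<close> are put in by hand.\<close>
  define gen where "gen = {(cscale c (single z), cscale c (ltr z q)) | c z. z \<in> carrier G}"
  define S where "S = span gen"
  have gen_graph: "gen \<subseteq> conv_graph q"
    by (auto simp: gen_def conv_graph_def conv_single_left fin_supp_def split: if_splits)
  then have S_graph: "S \<subseteq> conv_graph q"
    unfolding S_def by (rule span_minimal) (rule subspace_conv_graph)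
  define perp where "perp = {t. \<forall>s\<in>S. inner t s = 0}"
  have perp_iff: "t \<in> perp \<longleftrightarrow> (\<forall>s\<in>gen. inner t s = 0)" for t
  proof
    assume "\<forall>s\<in>gen. inner t s = 0"
    then have "S \<subseteq> {s. inner t s = 0}"
      unfolding S_def by (intro span_minimal) (auto simp: subspace_def inner_add_right)
    then show "t \<in> perp" by (auto simp: perp_def)
  qed (auto simp: perp_def S_def intro: span_base)
  have "\<forall>v. \<exists>r. v - r \<in> closure S \<and> r \<in> perp"
    using orthogonal_decomposition[of S] by (simp add: perp_def S_def subspace_span)
  then obtain P where P: "\<forall>v. v - P v \<in> closure S \<and> P v \<in> perp" by (rule choice[THEN exE])
  then have P1: "v - P v \<in> closure S" and P2: "P v \<in> perp" for v by blast+
  have P3: "inner (v - P v) t = 0" if "t \<in> perp" for v t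
  proof -
    have "closure S \<subseteq> {s. inner s t = 0}"
      using that by (intro closure_minimal closed_Collect_eq continuous_intros)
        (auto simp: perp_def inner_commute)
    then show ?thesis using P1 by blast
  qed
  \<comment> \<open>\<open>P\<close> comes from a choice; additivity, homogeneity and equivariance
    under \<open>U\<close> all follow from this uniqueness.\<close>
  have uniq: "P v = r" if r: "r \<in> perp" "\<And>t. t \<in> perp \<Longrightarrow> inner (v - r) t = 0" for v r
  proof -
    have "r - P v \<in> perp" using r(1) P2[of v] by (auto simp: perp_def inner_diff_left)
    from P3[OF this, of v] r(2)[OF this] have "inner (r - P v) (r - P v) = 0"
      by (simp add: inner_diff_left)
    then show ?thesis by simp
  qed
  have Padd: "P (v + w) = P v + P w" for v w
  proof (rule uniq)
    show "P v + P w \<in> perp" using P2[of v] P2[of w] by (simp add: perp_def inner_add_left)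
    show "inner (v + w - (P v + P w)) t = 0" if "t \<in> perp" for t
      using P3[OF that, of v] P3[OF that, of w] by (simp add: inner_add_left inner_diff_left)
  qed
  have Pscale: "P (r *\<^sub>R v) = r *\<^sub>R P v" for r v
  proof (rule uniq)
    show "r *\<^sub>R P v \<in> perp" using P2[of v] by (simp add: perp_def)
    show "inner (r *\<^sub>R v - r *\<^sub>R P v) t = 0" if "t \<in> perp" for t
      using P3[OF that, of v] by (simp flip: scaleR_diff_right)
  qed
  have Pnorm: "norm (P v) \<le> norm v" for v
  proof -
    have "norm (P v) * norm (P v) = inner v (P v)"
      using P3[OF P2[of v], of v] by (simp add: inner_diff_left power2_norm_eq_inner flip: power2_eq_square)
    also have "\<dots> \<le> norm v * norm (P v)" by (rule norm_cauchy_schwarz)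
    finally show ?thesis by (cases "P v = 0") auto
  qed
  have PB: "bounded_linear P"
    by (rule bounded_linear_intro[where K = 1]) (simp_all add: Padd Pscale Pnorm)
  have Uadj: "inner (U z c v) w = inner v (U (inv z) (cnj c) w)" if "z \<in> carrier G" for z c v w
    using that
    by (simp add: U_def inner_prod_def cinner_cscale cinner_cscale_right cinner_ltr flip: Re_cinner)
  have Ugen: "U z c s \<in> gen" if z: "z \<in> carrier G" and s: "s \<in> gen" for z c s
  proof -
    obtain d w where w: "w \<in> carrier G" "s = (cscale d (single w), cscale d (ltr w q))"
      using s unfolding gen_def by blast
    then have "U z c s = (cscale (c * d) (single (z \<otimes> w)), cscale (c * d) (ltr (z \<otimes> w) q))"
      using z by (simp add: U_def ltr_cscale ltr_single ltr_ltr cscale_cscale)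
    then show ?thesis using w z unfolding gen_def by blast
  qed
  have Uperp: "U z c t \<in> perp" if "z \<in> carrier G" "t \<in> perp" for z c t
    using that Ugen[of "inv z"] by (auto simp: perp_iff Uadj)
  have PU: "P (U z c v) = U z c (P v)" if z: "z \<in> carrier G" for z c v
  proof (rule uniq)
    show "U z c (P v) \<in> perp" using z P2 Uperp by blast
    fix t assume "t \<in> perp"
    then have "U (inv z) (cnj c) t \<in> perp" using z Uperp by blast
    from P3[OF this, of v] show "inner (U z c v - U z c (P v)) t = 0"
      using z by (simp add: inner_diff_left Uadj)
  qed
  \<comment> \<open>The choices of \<open>\<pi>\<close> and \<open>\<iota>\<close> run through the
    four entries of \<open>P\<close> as a two by two matrix. An entry commutes with left
    translations, so it is right convolution by its value at \<open>single \<one>\<close>, and it is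
    contractive because \<open>P\<close> is. The argument is first cut to the carrier, since
    convolution ignores values elsewhere.\<close>
  have key: "rb (\<pi> (P (\<iota> (single \<one>)))) 1 \<and>
      (\<forall>f. carr f \<longrightarrow> cv f (\<pi> (P (\<iota> (single \<one>)))) = \<pi> (P (\<iota> f)))"
    if pi: "\<pi> = fst \<or> \<pi> = snd" and iota: "\<iota> = (\<lambda>f. (f, 0)) \<or> \<iota> = (\<lambda>f. (0, f))" for \<pi> \<iota>
  proof -
    have pib: "bounded_linear \<pi>" using pi bounded_linear_fst bounded_linear_snd by auto
    have pin: "norm (\<pi> v) \<le> norm v" for v
      using pi by (cases v) (auto simp: norm_fst_le norm_snd_le)
    have piU: "\<pi> (U z c v) = cscale c (ltr z (\<pi> v))" for z c v using pi by (auto simp: U_def)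
    have iob: "bounded_linear \<iota>"
      using iota by (auto intro!: bounded_linear_Pair bounded_linear_ident bounded_linear_zero)
    have ion: "norm (\<iota> f) = norm f" for f using iota by auto
    have ioU: "\<iota> (cscale c (single z)) = U z c (\<iota> (single \<one>))" if "z \<in> carrier G" for c z
      using iota that by (auto simp: U_def ltr_single ltr_zero intro: l2_eqI)
    let ?a = "\<pi> (P (\<iota> (single \<one>)))" and ?T = "\<lambda>f. \<pi> (P (\<iota> (restr (carrier G) f)))"
    have TB: "bounded_linear ?T"
      by (intro bounded_linear_compose[OF pib] bounded_linear_compose[OF PB] bounded_linear_compose[OF iob] bounded_linear_restr)
    have T: "app (?T f) x = conv G (app f) (app ?a) x" for f x
    proof (rule l2_bounded_linear_eqI[of "\<lambda>f. app (?T f) x" "\<lambda>f. conv G (app f) (app ?a) x"])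
      have "bounded_linear (\<lambda>f. app f x)"
        by (rule bounded_linear_intro[where K = 1]) (auto simp: scaleR_conv_of_real cmod_app_le)
      then show "bounded_linear (\<lambda>f. app (?T f) x)" using TB by (rule bounded_linear_compose)
      show "bounded_linear (\<lambda>f. conv G (app f) (app ?a) x)" by (rule bounded_linear_conv_left)
      fix c z
      show "app (?T (cscale c (single z))) x = conv G (app (cscale c (single z))) (app ?a) x"
      proof (cases "z \<in> carrier G")
        case True
        then have "restr (carrier G) (cscale c (single z)) = cscale c (single z)" by (intro l2_eqI) auto
        then have "?T (cscale c (single z)) = cscale c (ltr z ?a)" using True by (simp add: ioU PU piU)
        then show ?thesis using True by (simp add: conv_single_left)
      next
        case False
        then have "restr (carrier G) (cscale c (single z)) = 0" by (intro l2_eqI) auto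
        moreover have "\<iota> 0 = 0" "P 0 = 0" "\<pi> 0 = 0"
          using iota pi Pscale[of 0 0] by (auto simp: zero_prod_def)
        ultimately show ?thesis using False by (simp add: conv_single_left)
      qed
    qed
    have cvT: "cv f ?a = ?T f" for f by (rule cv_eq) (rule ext, rule T)
    have "norm (?T f) \<le> norm f" for f
      using pin Pnorm norm_restr_le[of "carrier G" f] by (metis ion order_trans)
    then have "rb ?a 1" unfolding rb_def using T by (auto intro!: exI[of _ "?T f" for f])
    moreover have "restr (carrier G) f = f" if "carr f" for f using that by (intro l2_eqI) auto
    ultimately show ?thesis using cvT by auto
  qed
  have zero: "\<pi> (P (X, cv X q)) = 0" if pi: "\<pi> = fst \<or> \<pi> = snd" for \<pi>
  proof -
    have pib: "bounded_linear \<pi>" using pi bounded_linear_fst bounded_linear_snd by auto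
    interpret \<pi>: bounded_linear \<pi> by (rule pib)
    interpret L: bounded_linear "cv X" by (rule lb_bounded_linear[OF X(2)])
    define a c where "a = \<pi> (P (single \<one>, 0))" and "c = \<pi> (P (0, single \<one>))"
    have a: "rb a 1" "\<And>f. carr f \<Longrightarrow> cv f a = \<pi> (P (f, 0))"
      using key[OF pi, of "\<lambda>f. (f, 0)"] by (auto simp: a_def)
    have c: "rb c 1" "\<And>f. carr f \<Longrightarrow> cv f c = \<pi> (P (0, f))"
      using key[OF pi, of "\<lambda>f. (0, f)"] by (auto simp: c_def)
    have split: "P (f, h) = P (f, 0) + P (0, h)" for f h using Padd[of "(f, 0)" "(0, h)"] by simp
    have "(single \<one>, q) = (cscale 1 (single \<one>), cscale 1 (ltr \<one> q))" using q by (simp add: ltr_one)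
    then have "(single \<one>, q) \<in> gen" unfolding gen_def by blast
    then have "P (single \<one>, q) = 0"
      by (intro uniq) (auto simp: perp_def S_def span_base inner_commute)
    then have "\<pi> (P (single \<one>, 0)) + \<pi> (P (0, q)) = 0" using split[of "single \<one>" q] by (simp flip: \<pi>.add add: \<pi>.zero)
    then have 0: "cv (single \<one>) a + cv q c = 0" using a(2)[of "single \<one>"] c(2) q by auto
    have "\<pi> (P (X, cv X q)) = cv X a + cv (cv X q) c"
      using split[of X "cv X q"] a(2) c(2) X(1) lb_carr[OF X(2)] by (simp add: \<pi>.add)
    also have "cv X a = cv X (cv (single \<one>) a)"
      using cv_assoc[OF X(2) a(1), of "single \<one>"] cv_one_right[OF X(1)] by simp
    \<comment> \<open>\<open>q\<close> is merely square-summable; associativity holds because the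
      outer factors are left and right bounded.\<close>
    also have "cv (cv X q) c = cv X (cv q c)" using cv_assoc[OF X(2) c(1)] by simp
    finally show ?thesis using 0 by (simp add: L.zero flip: L.add)
  qed
  have "P (X, cv X q) = 0" using zero[of fst] zero[of snd] by (simp add: prod_eq_iff)
  then have "(X, cv X q) \<in> closure S" using P1[of "(X, cv X q)"] by simp
  then show ?thesis using closure_mono[OF S_graph] by blast
qed

lemma conv_fin_supp:
  assumes "finite A" "A \<subseteq> carrier G" "\<And>y. y \<notin> A \<Longrightarrow> app f y = 0" "x \<in> carrier G"
  shows "conv G (app f) g x = (\<Sum>y\<in>A. app f y * g (inv y \<otimes> x))"
proof -
  have "conv G (app f) g x = (\<Sum>\<^sub>\<infinity>y\<in>carrier G. app f y * g (inv y \<otimes> x))"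
    using assms(4) by (simp add: conv_def)
  also have "\<dots> = (\<Sum>\<^sub>\<infinity>y\<in>A. app f y * g (inv y \<otimes> x))"
    using assms by (intro infsum_cong_neutral) auto
  finally show ?thesis using assms(1) by simp
qed

text \<open>The Cotlar identity is summed with a finitely supported \<open>f\<close> in place of \<open>X\<close>, where all sums can be
  rearranged, and then \<open>f\<close> tends to \<open>X\<close> along the graph of convolution by the cut-off of \<open>Y\<close>.\<close>

lemma norm_product_outside:
  assumes X: "carr X" "lb X C" and Y: "carr Y" "lb Y C"
    and cotlar: "\<And>g h. g \<in> carrier G \<Longrightarrow> h \<in> carrier G \<Longrightarrow>
      (of_bool (inv g \<in> Q) - of_bool (h \<in> Q)) * (of_bool (g \<otimes> h \<in> Q) - of_bool (g \<in> Q)) =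
      - (of_bool (g \<in> B) * of_bool (h \<in> Q) :: complex)"
    and disj: "Q \<inter> B = {}"
    and A: "A = {g \<in> carrier G. inv g \<in> Q}"
    and e: "norm (restr (- A) X) \<le> e" "norm (restr (- Q) X) \<le> e" "norm (restr Q Y) \<le> e"
  shows "(norm (restr (- Q) (cv X Y)))\<^sup>2 \<le> 5 * C ^ 3 * e"
proof -
  define q where "q = restr Q Y"
  define W where "W = cv X Y"
  have C: "0 \<le> C" using X by (simp add: lb_def)
  have rY: "rb Y C" by (rule lb_rb[OF Y(2)])
  have lW: "lb W (C * C)" unfolding W_def by (rule lb_cv[OF X(2) Y(2)])
  have qc: "carr q" using Y by (auto simp: q_def)
  note BY = rb_bounded_linear[OF rY]
  interpret BY: bounded_linear "\<lambda>f. cv f Y" by (rule BY)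
  \<comment> \<open>These are the terms of the expanded Cotlar identity, weighted by
    \<open>f\<close> and \<open>Y\<close> and paired with \<open>W\<close>; disjointness of
    \<open>Q\<close> and \<open>B\<close> merges two of them into the last one. In the third,
    \<open>snd p\<close> stands for the convolution of \<open>f\<close> with \<open>q\<close>; in
    the last, \<open>q\<close> is moved over to \<open>W\<close>. This makes \<open>E\<close>
    continuous on pairs, so that it vanishes on the closure of the graph.\<close>
  define E where "E p = inner (cv (restr A (fst p)) Y) (restr Q W) - inner (cv (restr (A \<inter> Q) (fst p)) Y) W
      - inner (snd p) (restr Q W) + inner (restr (Q \<union> B) (fst p)) (cv W (star q))" for p
  have "E p = 0" if p: "p \<in> conv_graph q" for p
  proof -
    obtain f h where fh: "p = (f, h)" "fin_supp G (app f)" "app h = conv G (app f) (app q)"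
      using p by (auto simp: conv_graph_def)
    define K where "K = {x. app f x \<noteq> 0}"
    have K: "finite K" "K \<subseteq> carrier G" using fh by (auto simp: fin_supp_def K_def)
    define z where "z = (\<Sum>y\<in>K. cscale (app (restr (Q \<union> B) f) y) (ltr y q))"
    have rK: "restr K (restr (Q \<union> B) f) = restr (Q \<union> B) f" by (rule l2_eqI) (auto simp: K_def)
    have appz: "app z = conv G (app (restr (Q \<union> B) f)) (app q)"
      using conv_finite_left[OF K, of "restr (Q \<union> B) f" q] by (simp add: z_def rK)
    have zW: "inner z W = inner (restr (Q \<union> B) f) (cv W (star q))"
    proof -
      have "inner z W = (\<Sum>y\<in>K. inner (cscale (app (restr (Q \<union> B) f) y) (single y)) (cv W (star q)))"
        unfolding z_def inner_sum_left using K by (intro sum.cong refl inner_ltr_star[OF _ lW]) auto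
      also have "\<dots> = inner (restr K (restr (Q \<union> B) f)) (cv W (star q))"
        by (simp only: restr_finite[OF K(1)] inner_sum_left)
      finally show ?thesis by (simp only: rK)
    qed
    have "restr Q (cv (restr A f) Y) - cv (restr (A \<inter> Q) f) Y - restr Q h + z = 0"
    proof (rule l2_eqI)
      fix x
      show "app (restr Q (cv (restr A f) Y) - cv (restr (A \<inter> Q) f) Y - restr Q h + z) x = app 0 x"
      proof (cases "x \<in> carrier G")
        case x: True
        have c: "conv G (app (restr D f)) g x = (\<Sum>y\<in>K. app (restr D f) y * g (inv y \<otimes> x))" for D g
          by (rule conv_fin_supp[OF K _ x]) (auto simp: K_def)
        have c': "conv G (app f) g x = (\<Sum>y\<in>K. app f y * g (inv y \<otimes> x))" for g
          by (rule conv_fin_supp[OF K _ x]) (auto simp: K_def)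
        have "of_bool (x \<in> Q) * (app (restr A f) y * app Y (inv y \<otimes> x)) - app (restr (A \<inter> Q) f) y * app Y (inv y \<otimes> x)
            - of_bool (x \<in> Q) * (app f y * app q (inv y \<otimes> x)) + app (restr (Q \<union> B) f) y * app q (inv y \<otimes> x) = 0"
          if "y \<in> K" for y
        proof -
          have y: "y \<in> carrier G" using that K by auto
          have "y \<otimes> (inv y \<otimes> x) = x" using x y by (simp add: mult_inv_cancel)
          then show ?thesis
            using cotlar[OF y, of "inv y \<otimes> x"] disj x y
            by (cases "inv y \<in> Q"; cases "inv y \<otimes> x \<in> Q"; cases "x \<in> Q"; cases "y \<in> Q"; cases "y \<in> B")
              (auto simp: A q_def)
        qed
        then have "(\<Sum>y\<in>K. of_bool (x \<in> Q) * (app (restr A f) y * app Y (inv y \<otimes> x)) - app (restr (A \<inter> Q) f) y * app Y (inv y \<otimes> x)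
            - of_bool (x \<in> Q) * (app f y * app q (inv y \<otimes> x)) + app (restr (Q \<union> B) f) y * app q (inv y \<otimes> x)) = 0"
          by (intro sum.neutral) blast
        then have "of_bool (x \<in> Q) * conv G (app (restr A f)) (app Y) x - conv G (app (restr (A \<inter> Q) f)) (app Y) x
            - of_bool (x \<in> Q) * conv G (app f) (app q) x + conv G (app (restr (Q \<union> B) f)) (app q) x = 0"
          unfolding c c' by (simp only: sum.distrib sum_subtractf sum_distrib_left)
        moreover have "app (restr Q (cv (restr A f) Y) - cv (restr (A \<inter> Q) f) Y - restr Q h + z) x =
            of_bool (x \<in> Q) * conv G (app (restr A f)) (app Y) x - conv G (app (restr (A \<inter> Q) f)) (app Y) x
            - of_bool (x \<in> Q) * conv G (app f) (app q) x + conv G (app (restr (Q \<union> B) f)) (app q) x"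
          by (simp add: rb_app[OF rY] fh(3) appz)
        ultimately show ?thesis by simp
      qed (simp add: rb_app[OF rY] fh(3) appz conv_outside)
    qed
    then have "inner (restr Q (cv (restr A f) Y) - cv (restr (A \<inter> Q) f) Y - restr Q h + z) W = 0" by simp
    then show ?thesis
      by (simp add: E_def fh(1) inner_add_left inner_diff_left zW inner_restr)
  qed
  then have "conv_graph q \<subseteq> {p. E p = 0}" by blast
  moreover have "closed {p. E p = 0}"
  proof (rule closed_Collect_eq)
    note cont = bounded_linear.continuous_on[OF bounded_linear_compose[OF BY bounded_linear_restr]]
      bounded_linear.continuous_on[OF bounded_linear_restr]
    show "continuous_on UNIV E" unfolding E_def
      by (intro continuous_intros cont)
  qed simp
  ultimately have "closure (conv_graph q) \<subseteq> {p. E p = 0}" by (rule closure_minimal)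
  then have E0: "E (X, cv X q) = 0" using closure_conv_graph[OF X qc] by blast
  have nX: "norm X \<le> C" and nY: "norm Y \<le> C" using lb_norm_le X Y by auto
  have nW: "norm W \<le> C * C" unfolding W_def
    using lb_norm[OF X(2), of Y] mult_left_mono[OF nY C] by linarith
  have nQW: "norm (restr Q W) \<le> C * C" using norm_restr_le nW by (rule order_trans)
  have e0: "0 \<le> e" using e(1) norm_ge_zero order_trans by blast
  have cs: "\<bar>inner f g\<bar> \<le> a * b" if "norm f \<le> a" "norm g \<le> b" for f g :: "'a l2" and a b
    using Cauchy_Schwarz_ineq2[of f g] mult_mono[OF that] that by (meson norm_ge_zero order_trans)
  have bd: "norm (cv f Y) \<le> C * d" if "norm f \<le> d" for f d
    using rb_norm[OF rY, of f] mult_left_mono[OF that C] by linarith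
  have "restr (- (A \<inter> Q)) X = restr (- A) X + restr A (restr (- Q) X)" by (rule l2_eqI) auto
  then have "norm (restr (- (A \<inter> Q)) X) \<le> 2 * e"
    using norm_triangle_ineq[of "restr (- A) X" "restr A (restr (- Q) X)"] norm_restr_le[of A "restr (- Q) X"] e by auto
  then have e2: "\<bar>inner (cv (restr (- (A \<inter> Q)) X) Y) W\<bar> \<le> C * (2 * e) * (C * C)"
    by (intro cs bd nW)
  have e1: "\<bar>inner (cv (restr (- A) X) Y) (restr Q W)\<bar> \<le> C * e * (C * C)"
    by (intro cs bd nQW e)
  have "norm (cv X q) \<le> C * e"
    using lb_norm[OF X(2), of q] mult_left_mono[OF e(3) C] by (simp add: q_def)
  then have e3: "\<bar>inner (cv X q) (restr Q W)\<bar> \<le> C * e * (C * C)" by (intro cs nQW)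
  have "norm (star q) \<le> e" using norm_star[of q] e(3) by (simp add: q_def)
  then have "norm (cv W (star q)) \<le> C * C * e"
    using lb_norm[OF lW, of "star q"] mult_left_mono[of _ e "C * C"] C by (meson mult_nonneg_nonneg order_trans)
  then have e4: "\<bar>inner (restr (Q \<union> B) X) (cv W (star q))\<bar> \<le> C * (C * C * e)"
    using norm_restr_le nX by (intro cs) (auto intro: order_trans)
  have split: "W = cv (restr D X) Y + cv (restr (- D) X) Y" for D
    unfolding W_def by (simp add: restr_add_compl flip: BY.add)
  have s1: "inner W (restr Q W) = inner (cv (restr A X) Y) (restr Q W) + inner (cv (restr (- A) X) Y) (restr Q W)"
    using split[of A] by (metis inner_add_left)
  have s2: "inner W W = inner (cv (restr (A \<inter> Q) X) Y) W + inner (cv (restr (- (A \<inter> Q)) X) Y) W"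
    using split[of "A \<inter> Q"] by (metis inner_add_left)
  have "restr Q W + restr (- Q) W = W" by (rule restr_add_compl)
  \<comment> \<open>Up to \<open>e1\<close> and \<open>e2\<close>, the first two terms of
    \<open>E\<close> are \<open>inner W (restr Q W)\<close> and \<open>inner W W\<close>, whose
    difference is the mass outside \<open>Q\<close>; the other two terms are small with
    \<open>q\<close>. The constant is 5 = 1 + 2 + 1 + 1, as cutting \<open>X\<close> to
    \<open>A \<inter> Q\<close> costs \<open>e\<close> twice.\<close>
  then have "(norm (restr (- Q) W))\<^sup>2 = inner W W - inner W (restr Q W)"
    unfolding inner_restr_self[of W "- Q", symmetric] by (metis add_diff_cancel_left' inner_diff_right)
  also have "\<dots> \<le> 5 * C ^ 3 * e"
    using e1 e2 e3 e4 E0 unfolding s1 s2 E_def by (simp add: power3_eq_cube algebra_simps abs_le_iff)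
  finally show ?thesis by (simp add: W_def)
qed

text \<open>The translates of \<open>E\<close> under conjugation by powers of \<open>g\<close> are disjoint and carry almost equal mass.\<close>

lemma norm_restr_conj_le:
  assumes g: "g \<in> carrier G" and X: "carr X" and E: "E \<subseteq> carrier G"
    and wand: "\<And>n x. n \<ge> 1 \<Longrightarrow> x \<in> E \<Longrightarrow> g [^] (n::nat) \<otimes> x \<otimes> inv (g [^] n) \<notin> E"
    and N: "N \<ge> 1"
  shows "norm (restr E X) \<le> norm X / sqrt (real N) + real N * norm (ltr g X - rtr g X)"
proof -
  define d where "d = norm (ltr g X - rtr g X)"
  \<comment> \<open>\<open>V f\<close> at \<open>x\<close> is \<open>f\<close> at the conjugate of
    \<open>x\<close> by \<open>g\<close>. Since \<open>V\<close> is a contraction, its k-th power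
    moves \<open>X\<close> by at most \<open>k\<close> times the commutator norm.\<close>
  define V where "V f = ltr (inv g) (rtr g f)" for f
  define \<phi> where "\<phi> k x = g [^] (k::nat) \<otimes> x \<otimes> inv (g [^] k)" for k x
  interpret L: bounded_linear "ltr (inv g)" using g by (intro bounded_linear_ltr) simp
  interpret R: bounded_linear "rtr g" using g by (intro bounded_linear_rtr) simp
  have \<phi>: "\<phi> k x \<in> carrier G" if "x \<in> carrier G" for k x using that g by (simp add: \<phi>_def)
  have Vn: "norm (V f) \<le> norm f" for f
    unfolding V_def using norm_ltr[of "inv g"] norm_rtr[of g] g by (meson inv_closed order_trans)
  have Vd: "V f - V h = V (f - h)" for f h by (simp add: V_def L.diff R.diff)
  have "X - V X = ltr (inv g) (ltr g X - rtr g X)"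
    using g X by (simp add: V_def L.diff ltr_ltr ltr_one)
  then have d1: "norm (X - V X) \<le> d" unfolding d_def using norm_ltr g by simp
  have Vk: "norm (X - (V ^^ k) X) \<le> real k * d" for k
  proof (induction k)
    case (Suc k)
    have "X - (V ^^ Suc k) X = (X - V X) + V (X - (V ^^ k) X)" by (simp flip: Vd)
    then have "norm (X - (V ^^ Suc k) X) \<le> norm (X - V X) + norm (V (X - (V ^^ k) X))"
      by (metis norm_triangle_ineq)
    also have "\<dots> \<le> d + real k * d" using d1 Vn[of "X - (V ^^ k) X"] Suc.IH by linarith
    finally show ?case by (simp add: algebra_simps)
  qed simp
  have appV: "app ((V ^^ k) f) x = app f (\<phi> k x)" if "x \<in> carrier G" for k f x
    using that
  proof (induction k arbitrary: x)
    case (Suc k)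
    have "app ((V ^^ Suc k) f) x = app ((V ^^ k) f) (g \<otimes> x \<otimes> inv g)"
      using g Suc.prems by (simp add: V_def app_ltr app_rtr)
    also have "\<dots> = app f (\<phi> k (g \<otimes> x \<otimes> inv g))" using g Suc by simp
    also have "\<phi> k (g \<otimes> x \<otimes> inv g) = \<phi> (Suc k) x"
      using g Suc.prems by (simp add: \<phi>_def m_assoc inv_mult_group)
    finally show ?case .
  qed (simp add: \<phi>_def)
  have Vkn: "norm ((V ^^ k) f) \<le> norm f" for k f
    by (induction k) (auto intro: order_trans[OF Vn])
  have step: "norm (restr E X) \<le> norm (restr (\<phi> k ` E) X) + real k * d" for k
  proof -
    have "restr E X = restr E (X - (V ^^ k) X) + restr E ((V ^^ k) X)" by (rule l2_eqI) simp
    then have "norm (restr E X) \<le> norm (restr E (X - (V ^^ k) X)) + norm (restr E ((V ^^ k) X))"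
      by (metis norm_triangle_ineq)
    moreover have "norm (restr E (X - (V ^^ k) X)) \<le> real k * d"
      using norm_restr_le Vk by (rule order_trans)
    moreover have "norm (restr E ((V ^^ k) X)) \<le> norm ((V ^^ k) (restr (\<phi> k ` E) X))"
      by (rule norm_mono_app) (use E in \<open>auto simp: appV subset_iff\<close>)
    ultimately show ?thesis using Vkn[of k "restr (\<phi> k ` E) X"] by linarith
  qed
  have disj: "\<phi> j ` E \<inter> \<phi> k ` E = {}" if "j < k" for j k
  proof -
    have False if xy: "x \<in> E" "y \<in> E" "\<phi> j x = \<phi> k y" for x y
    proof -
      have c: "x \<in> carrier G" "y \<in> carrier G" using xy E by auto
      define m where "m = k - j"
      have m: "k = j + m" "m \<ge> 1" using \<open>j < k\<close> by (auto simp: m_def)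
      have "\<phi> k y = \<phi> j (\<phi> m y)"
        using g c by (simp add: \<phi>_def m inv_mult_group m_assoc flip: nat_pow_mult)
      then have "\<phi> j x = \<phi> j (\<phi> m y)" using xy by simp
      then have "x = \<phi> m y" using g c \<phi>[OF c(2)] by (simp add: \<phi>_def)
      then show False using wand[OF m(2) xy(2)] xy(1) by (simp add: \<phi>_def)
    qed
    then show ?thesis by blast
  qed
  have sum: "(\<Sum>k<M. (norm (restr (\<phi> k ` E) X))\<^sup>2) = (norm (restr (\<Union>k<M. \<phi> k ` E) X))\<^sup>2" for M
  proof (induction M)
    case 0
    have "restr {} X = 0" by (rule l2_eqI) simp
    then show ?case by simp
  next
    case (Suc M)
    let ?D = "\<Union>k<M. \<phi> k ` E"
    have dj: "?D \<inter> \<phi> M ` E = {}" using disj by fastforce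
    have "restr (\<Union>k<Suc M. \<phi> k ` E) X = restr ?D X + restr (\<phi> M ` E) X"
      by (rule l2_eqI) (use dj in \<open>auto simp: lessThan_Suc\<close>)
    moreover have "inner (restr ?D X) (restr (\<phi> M ` E) X) = 0"
    proof -
      have "restr (\<phi> M ` E) (restr ?D X) = 0" by (rule l2_eqI) (use dj in auto)
      then show ?thesis by (simp add: inner_restr)
    qed
    ultimately show ?case using Suc.IH
      by (simp add: power2_norm_eq_inner inner_add_left inner_add_right inner_commute)
  qed
  \<comment> \<open>Pigeonhole: \<open>N\<close> disjoint translates share the mass of
    \<open>X\<close>, so one of them carries at most an \<open>N\<close>-th of the squared norm.
    Transporting this bound back to \<open>E\<close> costs at most \<open>N * d\<close>.\<close>
  have "\<exists>k<N. norm (restr (\<phi> k ` E) X) \<le> norm X / sqrt (real N)"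
  proof (rule ccontr)
    assume "\<not> ?thesis"
    then have "norm X / sqrt (real N) < norm (restr (\<phi> k ` E) X)" if "k < N" for k using that by force
    then have "(norm X / sqrt (real N))\<^sup>2 < (norm (restr (\<phi> k ` E) X))\<^sup>2" if "k < N" for k
      using that by (intro power_strict_mono) auto
    then have "(\<Sum>k<N. (norm X / sqrt (real N))\<^sup>2) < (\<Sum>k<N. (norm (restr (\<phi> k ` E) X))\<^sup>2)"
      using N by (intro sum_strict_mono) (auto simp: lessThan_empty_iff)
    also have "\<dots> \<le> (norm X)\<^sup>2" unfolding sum by (intro power_mono norm_restr_le) simp
    finally show False using N by (simp add: power_divide)
  qed
  then obtain k where k: "k < N" "norm (restr (\<phi> k ` E) X) \<le> norm X / sqrt (real N)" by blast
  have "real k * d \<le> real N * d" using k by (intro mult_right_mono) (auto simp: d_def)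
  then show ?thesis using step[of k] k by (simp add: d_def)
qed

end

section \<open>Commuting sequences in the ultrapower\<close>

context group
begin

section \<open>Group elements as Haar unitaries, and uniformly bounded sequences\<close>

lemma delta_single: "delta g = app (single g)"
  by (rule ext) (simp add: delta_def)

lemma conv_delta_left: "g \<in> carrier G \<Longrightarrow> conv G (delta g) (app f) = app (ltr g f)"
  using conv_single_left[of 1 g f] by (simp add: delta_single)

lemma conv_delta_right: "g \<in> carrier G \<Longrightarrow> conv G (app f) (delta g) = app (rtr g f)"
  using conv_single_right[of f 1 g] by (simp add: delta_single)

lemma conv_delta: "g \<in> carrier G \<Longrightarrow> h \<in> carrier G \<Longrightarrow> conv G (delta g) (delta h) = delta (g \<otimes> h)"
  by (simp add: delta_single[of h] conv_delta_left ltr_single) (simp add: delta_single)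

lemma adjL_delta: "g \<in> carrier G \<Longrightarrow> adjL G (delta g) = delta (inv g)"
  by (auto simp: adjL_def delta_def fun_eq_iff)

lemma powL_delta: "g \<in> carrier G \<Longrightarrow> powL G (delta g) n = delta (g [^] n)"
proof (induction n)
  case (Suc n)
  then have "powL G (delta g) (Suc n) = delta (g \<otimes> g [^] n)"
    by (simp add: powL_def conv_delta)
  then show ?case using nat_pow_Suc2[OF Suc.prems, of n] by (simp del: nat_pow_Suc)
qed (simp add: powL_def unitL_def)

lemma lb_single: assumes "g \<in> carrier G" shows "lb (single g) 1"
  unfolding lb_def
proof (intro conjI allI)
  fix f
  show "\<exists>h. app h = conv G (app (single g)) (app f) \<and> norm h \<le> 1 * norm f"
    using conv_single_left[of 1 g f] assms norm_ltr[OF assms, of f] by (intro exI[of _ "ltr g f"]) simp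
qed simp

lemma carr_single: "g \<in> carrier G \<Longrightarrow> carr (single g)"
  by auto

lemma norm2_diff: "carr f \<Longrightarrow> carr h \<Longrightarrow> norm2 G (\<lambda>x. app f x - app h x) = norm (f - h)"
proof -
  have "(\<lambda>x. app f x - app h x) = app (f - h)" by (rule ext) simp
  then show "carr f \<Longrightarrow> carr h \<Longrightarrow> ?thesis" by (simp add: norm2_app)
qed

lemma ueq_refl: "ueq G F X X"
  by (simp add: ueq_def norm2_def)

lemma commU_refl: "commU G F X X"
  by (simp add: commU_def ueq_refl)

lemma commU_sym: "commU G F X Y \<Longrightarrow> commU G F Y X"
  by (simp add: commU_def ueq_def norm2_def norm_minus_commute)

lemma commU_delta:
  assumes "g \<in> carrier G" "h \<in> carrier G" "g \<otimes> h = h \<otimes> g"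
  shows "commU G F (\<lambda>_. delta g) (\<lambda>_. delta h)"
  using assms by (simp add: commU_def conv_delta ueq_refl)

lemma haarU_delta:
  assumes g: "g \<in> carrier G" "\<And>n. n \<ge> 1 \<Longrightarrow> g [^] (n::nat) \<noteq> \<one>"
  shows "(\<lambda>_. delta g) \<in> haarU G F"
proof -
  have "op_bound G (delta g) 1" unfolding delta_single by (rule lb_op_bound[OF lb_single[OF g(1)]])
  moreover have "delta g \<in> ell2 G" unfolding delta_single by (rule ell2_app[OF carr_single[OF g(1)]])
  ultimately have "(\<lambda>_::nat. delta g) \<in> ultra_seq G" by (auto simp: ultra_seq_def vnL_def)
  moreover have "traceL G (powL G (delta g) n) = 0" if "n \<ge> 1" for n
    using g(2)[OF that] by (simp add: powL_delta[OF g(1)] traceL_def) (auto simp: delta_def)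
  ultimately show ?thesis
    using g by (simp add: haarU_def adjL_delta conv_delta unitL_def ueq_refl)
qed

lemma lb_mono: "lb u C \<Longrightarrow> C \<le> D \<Longrightarrow> lb u D"
  unfolding lb_def by (meson mult_right_mono norm_ge_zero order_trans)

lemma ultra_seqE:
  assumes "X \<in> ultra_seq G"
  obtains x C where "\<And>n. app (x n) = X n" "\<And>n. carr (x n)" "\<And>n. lb (x n) C"
proof -
  obtain C where C: "\<And>n. X n \<in> vnL G" "\<And>n. op_bound G (X n) C" using assms by (auto simp: ultra_seq_def)
  have "\<forall>n. \<exists>u. app u = X n \<and> carr u \<and> lb u (max 0 C)"
  proof
    fix n
    obtain u where "app u = X n" "carr u" "lb u (max 0 C)" by (rule vnLE[OF C(1) C(2)])
    then show "\<exists>u. app u = X n \<and> carr u \<and> lb u (max 0 C)" by blast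
  qed
  then obtain x where "\<forall>n. app (x n) = X n \<and> carr (x n) \<and> lb (x n) (max 0 C)" by (rule choice[THEN exE])
  then show thesis using that[of x "max 0 C"] by blast
qed

lemma norm_restr_tendsto_zero:
  assumes g: "g \<in> carrier G" and E: "E \<subseteq> carrier G"
    and wand: "\<And>n x. n \<ge> 1 \<Longrightarrow> x \<in> E \<Longrightarrow> g [^] (n::nat) \<otimes> x \<otimes> inv (g [^] n) \<notin> E"
    and x: "\<And>n. carr (x n)" "\<And>n. lb (x n) C"
    and comm: "commU G F (\<lambda>_. delta g) (\<lambda>n. app (x n))"
  shows "((\<lambda>n. norm (restr E (x n))) \<longlongrightarrow> 0) F"
proof (rule tendstoI)
  fix e :: real assume e: "0 < e"
  have d: "((\<lambda>n. norm (ltr g (x n) - rtr g (x n))) \<longlongrightarrow> 0) F"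
  proof -
    have "norm2 G (\<lambda>y. conv G (delta g) (app (x n)) y - conv G (app (x n)) (delta g) y) = norm (ltr g (x n) - rtr g (x n))" for n
      unfolding conv_delta_left[OF g] conv_delta_right[OF g] by (rule norm2_diff) (use g in \<open>simp_all add: app_ltr app_rtr\<close>)
    then show ?thesis using comm by (simp add: commU_def ueq_def)
  qed
  have C: "0 \<le> C" using x(2) by (simp add: lb_def)
  \<comment> \<open>\<open>N\<close> is fixed first, so that \<open>C / sqrt N\<close> is below
    \<open>e / 2\<close> uniformly in \<open>n\<close>. Only then is the commutator made smaller
    than \<open>e / (2 N)\<close> along \<open>F\<close>.\<close>
  obtain N :: nat where N: "(2 * C / e + 1)\<^sup>2 < real N" using reals_Archimedean2 by blast
  have s: "2 * C / e + 1 < sqrt (real N)" using N by (rule real_less_rsqrt)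
  have pos: "0 \<le> 2 * C / e" using C e by simp
  have s0: "0 < sqrt (real N)" using s pos by linarith
  then have N1: "N \<ge> 1" by (cases N) auto
  have "2 * C / e < sqrt (real N)" using s by linarith
  then have CN: "C / sqrt (real N) < e / 2" using e s0 by (simp add: field_simps)
  have "\<forall>\<^sub>F n in F. dist (norm (ltr g (x n) - rtr g (x n))) 0 < e / 2 / real N"
    using d e N1 by (intro tendstoD) auto
  then show "\<forall>\<^sub>F n in F. dist (norm (restr E (x n))) 0 < e"
  proof (rule eventually_mono)
    fix n assume "dist (norm (ltr g (x n) - rtr g (x n))) 0 < e / 2 / real N"
    then have "real N * norm (ltr g (x n) - rtr g (x n)) < e / 2" using N1 by (simp add: field_simps)
    moreover have "norm (x n) / sqrt (real N) \<le> C / sqrt (real N)"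
      using lb_norm_le[OF x(2) x(1)] s0 by (intro divide_right_mono) auto
    ultimately have "norm (restr E (x n)) < e"
      using norm_restr_conj_le[OF g x(1) E wand N1, of n] CN by linarith
    then show "dist (norm (restr E (x n))) 0 < e" by simp
  qed
qed

text \<open>If the products tended to 0, so would \<open>y\<close>, which is close to
  \<open>cv (star x) (cv x y)\<close>; but the product of \<open>star y\<close> and \<open>y\<close>
  is close to the unit. The factors are unitary only in the limit, so the uniform bound
  \<open>C\<close> controls the errors.\<close>

lemma unitary_product_not_null:
  assumes F: "F \<noteq> bot"
    and x: "\<And>n. carr (x n)" "\<And>n. lb (x n) C" and y: "\<And>n. carr (y n)" "\<And>n. lb (y n) C"
    and ux: "ueq G F (\<lambda>n. conv G (adjL G (app (x n))) (app (x n))) (\<lambda>n. unitL G)"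
    and uy: "ueq G F (\<lambda>n. conv G (adjL G (app (y n))) (app (y n))) (\<lambda>n. unitL G)"
  shows "\<not> ((\<lambda>n. norm (cv (x n) (y n))) \<longlongrightarrow> 0) F"
proof
  assume W: "((\<lambda>n. norm (cv (x n) (y n))) \<longlongrightarrow> 0) F"
  have C: "0 \<le> C" using x(2) by (simp add: lb_def)
  have u: "((\<lambda>n. norm (cv (star (z n)) (z n) - single \<one>)) \<longlongrightarrow> 0) F"
    if z: "\<And>n. lb (z n) C" and "ueq G F (\<lambda>n. conv G (adjL G (app (z n))) (app (z n))) (\<lambda>n. unitL G)" for z
  proof -
    have "norm2 G (\<lambda>t. conv G (adjL G (app (z n))) (app (z n)) t - unitL G t) = norm (cv (star (z n)) (z n) - single \<one>)" for n
      using norm2_diff[OF lb_carr[OF lb_star[OF z]] carr_single[OF one_closed], of n "z n"]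
      by (simp only: lb_app[OF lb_star[OF z]] app_star unitL_def delta_single)
    then show ?thesis using that by (simp add: ueq_def)
  qed
  note rx = u[OF x(2) ux] and ry = u[OF y(2) uy]
  have yn: "norm (y n) \<le> C * norm (cv (x n) (y n)) + C * norm (cv (star (x n)) (x n) - single \<one>)" for n
  proof -
    note R = rb_bounded_linear[OF lb_rb[OF y(2)[of n]]]
    interpret bounded_linear "\<lambda>f. cv f (y n)" by (rule R)
    let ?r = "cv (star (x n)) (x n) - single \<one>"
    have "cv (single \<one>) (y n) = y n"
      using cv_single_left[of \<one> 1 "y n"] ltr_one[OF y(1)] by simp
    then have "cv (cv (star (x n)) (x n)) (y n) - y n = cv ?r (y n)" by (simp add: diff)
    then have "y n = cv (star (x n)) (cv (x n) (y n)) - cv ?r (y n)"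
      using cv_assoc[OF lb_star[OF x(2)] lb_rb[OF y(2)], of n "x n" n] by (simp add: algebra_simps)
    then have "norm (y n) \<le> norm (cv (star (x n)) (cv (x n) (y n))) + norm (cv ?r (y n))"
      by (metis norm_triangle_ineq4)
    also have "\<dots> \<le> C * norm (cv (x n) (y n)) + C * norm ?r"
      using lb_norm[OF lb_star[OF x(2)]] rb_norm[OF lb_rb[OF y(2)]] by (intro add_mono)
    finally show ?thesis .
  qed
  have "1 \<le> C * norm (y n) + norm (cv (star (y n)) (y n) - single \<one>)" for n
  proof -
    have "single \<one> = cv (star (y n)) (y n) - (cv (star (y n)) (y n) - single \<one>)" by simp
    then have "norm (single \<one>) \<le> norm (cv (star (y n)) (y n)) + norm (cv (star (y n)) (y n) - single \<one>)"
      by (metis norm_triangle_ineq4)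
    then show ?thesis using lb_norm[OF lb_star[OF y(2)], of n "y n"] by simp
  qed
  then have "1 \<le> C * (C * norm (cv (x n) (y n)) + C * norm (cv (star (x n)) (x n) - single \<one>))
      + norm (cv (star (y n)) (y n) - single \<one>)" for n
    using mult_left_mono[OF yn C] by (meson add_right_mono order_trans)
  moreover have "((\<lambda>n. C * (C * norm (cv (x n) (y n)) + C * norm (cv (star (x n)) (x n) - single \<one>))
      + norm (cv (star (y n)) (y n) - single \<one>)) \<longlongrightarrow> C * (C * 0 + C * 0) + 0) F"
    by (intro tendsto_intros W rx ry)
  ultimately have "(1::real) \<le> C * (C * 0 + C * 0) + 0"
    by (intro tendsto_lowerbound[OF _ _ F]) auto
  then show False by simp
qed

end

text \<open>Inversion reverses routes, so the two conditions mean concentration on elements whose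
  route both starts and ends with \<open>s\<close>.\<close>

definition ends_in :: "nat filter \<Rightarrow> bool \<Rightarrow> (nat \<Rightarrow> (nat \<times> bool) list set l2) \<Rightarrow> bool" where
  "ends_in F s x \<longleftrightarrow> ((\<lambda>n. norm (restr (- branch s) (x n))) \<longlongrightarrow> 0) F \<and>
     ((\<lambda>n. norm (restr (- {g \<in> carrier raag. inv\<^bsub>raag\<^esub> g \<in> branch s}) (x n))) \<longlongrightarrow> 0) F"

text \<open>Every nontrivial element outside the branch is conjugated into it, so no mass can stay
  outside except at the identity, where the trace condition for the first power removes it. The
  second condition follows in the same way because conjugation commutes with inversion.\<close>

lemma ends_in_of_commU:
  assumes i: "i = 0 \<or> i = 4"
    and x: "\<And>n. \<forall>g. g \<notin> carrier raag \<longrightarrow> app (x n) g = 0" "\<And>n. group.lb raag (x n) C"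
    and haar: "(\<lambda>n. app (x n)) \<in> haarU raag F"
    and comm: "commU raag F (\<lambda>_. delta (raag_gen i)) (\<lambda>n. app (x n))"
  shows "ends_in F (i < 2) x"
proof -
  have i5: "raag_gen i \<in> carrier raag" using i by auto
  have tr: "((\<lambda>n. norm (restr {\<one>\<^bsub>raag\<^esub>} (x n))) \<longlongrightarrow> 0) F"
  proof -
    have "((\<lambda>n. traceL raag (powL raag (app (x n)) 1)) \<longlongrightarrow> 0) F" using haar by (simp add: haarU_def)
    moreover have "traceL raag (powL raag (app (x n)) 1) = app (x n) \<one>\<^bsub>raag\<^esub>" for n
      by (simp add: traceL_def powL_def unitL_def raag.conv_delta_right[OF raag.one_closed] raag.app_rtr[OF raag.one_closed])
    moreover have "norm (restr {\<one>\<^bsub>raag\<^esub>} (x n)) = cmod (app (x n) \<one>\<^bsub>raag\<^esub>)" for n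
      using restr_finite[of "{\<one>\<^bsub>raag\<^esub>}" "x n"] by simp
    ultimately show ?thesis by (simp only: tendsto_norm_zero)
  qed
  have conc: "((\<lambda>n. norm (restr (- Q) (x n))) \<longlongrightarrow> 0) F"
    if Q: "\<And>n g. n \<ge> 1 \<Longrightarrow> g \<in> carrier raag \<Longrightarrow> g \<noteq> \<one>\<^bsub>raag\<^esub> \<Longrightarrow> g \<notin> Q \<Longrightarrow>
      raag_gen i [^]\<^bsub>raag\<^esub> (n::nat) \<otimes>\<^bsub>raag\<^esub> g \<otimes>\<^bsub>raag\<^esub> inv\<^bsub>raag\<^esub> (raag_gen i [^]\<^bsub>raag\<^esub> n) \<in> Q" for Q
  proof -
    define E where "E = carrier raag - {\<one>\<^bsub>raag\<^esub>} - Q"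
    have E: "((\<lambda>n. norm (restr E (x n))) \<longlongrightarrow> 0) F"
    proof (rule raag.norm_restr_tendsto_zero[OF i5 _ _ x comm])
      show "E \<subseteq> carrier raag" by (auto simp: E_def)
      fix n :: nat and g assume n: "n \<ge> 1" and "g \<in> E"
      then have "g \<in> carrier raag" "g \<noteq> \<one>\<^bsub>raag\<^esub>" "g \<notin> Q" by (simp_all add: E_def)
      from Q[OF n this] show "raag_gen i [^]\<^bsub>raag\<^esub> n \<otimes>\<^bsub>raag\<^esub> g \<otimes>\<^bsub>raag\<^esub> inv\<^bsub>raag\<^esub> (raag_gen i [^]\<^bsub>raag\<^esub> n) \<notin> E"
        by (simp add: E_def)
    qed
    have le: "norm (restr (- Q) (x n)) \<le> norm (restr E (x n)) + norm (restr {\<one>\<^bsub>raag\<^esub>} (x n))" for n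
    proof -
      have eq: "restr (- Q) (x n) = restr E (x n) + restr (- Q) (restr {\<one>\<^bsub>raag\<^esub>} (x n))"
        by (rule l2_eqI) (use x(1) in \<open>auto simp: E_def\<close>)
      show ?thesis unfolding eq
        using norm_triangle_ineq[of "restr E (x n)" "restr (- Q) (restr {\<one>\<^bsub>raag\<^esub>} (x n))"]
          norm_restr_le[of "- Q" "restr {\<one>\<^bsub>raag\<^esub>} (x n)"] by linarith
    qed
    have lim: "((\<lambda>n. norm (restr E (x n)) + norm (restr {\<one>\<^bsub>raag\<^esub>} (x n))) \<longlongrightarrow> 0) F"
      using tendsto_add[OF E tr] by simp
    show ?thesis by (rule tendsto_sandwich[OF _ _ tendsto_const lim]) (simp_all add: le)
  qed
  show ?thesis unfolding ends_in_def
  proof (intro conjI conc)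
    fix n :: nat and g
    assume n: "n \<ge> 1" and g: "g \<in> carrier raag" "g \<noteq> \<one>\<^bsub>raag\<^esub>"
    show "raag_gen i [^]\<^bsub>raag\<^esub> n \<otimes>\<^bsub>raag\<^esub> g \<otimes>\<^bsub>raag\<^esub> inv\<^bsub>raag\<^esub> (raag_gen i [^]\<^bsub>raag\<^esub> n) \<in> branch (i < 2)"
      if "g \<notin> branch (i < 2)"
      by (rule branch_conj[OF i n g that])
    show "raag_gen i [^]\<^bsub>raag\<^esub> n \<otimes>\<^bsub>raag\<^esub> g \<otimes>\<^bsub>raag\<^esub> inv\<^bsub>raag\<^esub> (raag_gen i [^]\<^bsub>raag\<^esub> n)
        \<in> {g \<in> carrier raag. inv\<^bsub>raag\<^esub> g \<in> branch (i < 2)}"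
      if "g \<notin> {g \<in> carrier raag. inv\<^bsub>raag\<^esub> g \<in> branch (i < 2)}"
    proof -
      have "inv\<^bsub>raag\<^esub> g \<noteq> \<one>\<^bsub>raag\<^esub>" using g by (simp add: raag.inv_eq_1_iff)
      then have "raag_gen i [^]\<^bsub>raag\<^esub> n \<otimes>\<^bsub>raag\<^esub> inv\<^bsub>raag\<^esub> g \<otimes>\<^bsub>raag\<^esub> inv\<^bsub>raag\<^esub> (raag_gen i [^]\<^bsub>raag\<^esub> n) \<in> branch (i < 2)"
        using g that by (intro branch_conj[OF i n]) auto
      then show ?thesis using g i5 by (simp add: raag.inv_mult_group raag.m_assoc)
    qed
  qed
qed

text \<open>\<open>y\<close> concentrates on the opposite branch, which is disjoint from
  \<open>branch s\<close>; its cut-off to \<open>branch s\<close> is therefore the small vector that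
  \<open>norm_product_outside\<close> asks for.\<close>

lemma ends_in_product:
  assumes x: "\<And>n. \<forall>g. g \<notin> carrier raag \<longrightarrow> app (x n) g = 0" "\<And>n. group.lb raag (x n) C"
    and y: "\<And>n. \<forall>g. g \<notin> carrier raag \<longrightarrow> app (y n) g = 0" "\<And>n. group.lb raag (y n) C"
    and xs: "ends_in F s x" and ys: "ends_in F (\<not> s) y"
  shows "((\<lambda>n. norm (restr (- branch s) (group.cv raag (x n) (y n)))) \<longlongrightarrow> 0) F"
proof -
  define A where "A = {g \<in> carrier raag. inv\<^bsub>raag\<^esub> g \<in> branch s}"
  define e where "e n = norm (restr (- A) (x n)) + norm (restr (- branch s) (x n)) + norm (restr (- branch (\<not> s)) (y n))" for n
  have "(e \<longlongrightarrow> 0 + 0 + 0) F"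
    unfolding e_def by (intro tendsto_add) (use xs ys in \<open>auto simp: ends_in_def A_def\<close>)
  then have "((\<lambda>n. sqrt (5 * C ^ 3 * e n)) \<longlongrightarrow> sqrt (5 * C ^ 3 * (0 + 0 + 0))) F"
    by (intro tendsto_intros)
  then have lim: "((\<lambda>n. sqrt (5 * C ^ 3 * e n)) \<longlongrightarrow> 0) F" by simp
  have le: "norm (restr (- branch s) (group.cv raag (x n) (y n))) \<le> sqrt (5 * C ^ 3 * e n)" for n
  proof (rule real_le_rsqrt, rule raag.norm_product_outside[OF x y, where B = trunk and A = A])
    show "branch s \<inter> trunk = {}" by (auto simp: branch_def trunk_def)
    have "branch s \<subseteq> - branch (\<not> s)" using branch_disjoint by (cases s) auto
    then have "norm (restr (branch s) (y n)) \<le> norm (restr (- branch (\<not> s)) (y n))"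
      by (intro norm_mono_app) auto
    moreover have "0 \<le> norm (restr (- A) (x n))" "0 \<le> norm (restr (- branch s) (x n))" by simp_all
    ultimately show "norm (restr (branch s) (y n)) \<le> e n" unfolding e_def by linarith
  qed (simp_all add: A_def e_def branch_cotlar)
  show ?thesis by (rule tendsto_sandwich[OF _ _ tendsto_const lim]) (simp_all add: le)
qed

lemma no_commuting_haar_pair:
  assumes F: "F \<noteq> bot" and X: "X \<in> haarU raag F" and Y: "Y \<in> haarU raag F"
    and c1: "commU raag F (\<lambda>_. delta (raag_gen 0)) X" and c2: "commU raag F X Y"
    and c3: "commU raag F Y (\<lambda>_. delta (raag_gen 4))"
  shows False
proof -
  obtain x C where x: "\<And>n. app (x n) = X n" "\<And>n. \<forall>g. g \<notin> carrier raag \<longrightarrow> app (x n) g = 0" "\<And>n. raag.lb (x n) C"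
    by (rule raag.ultra_seqE[of X]) (use X in \<open>auto simp: haarU_def\<close>)
  obtain y D where y: "\<And>n. app (y n) = Y n" "\<And>n. \<forall>g. g \<notin> carrier raag \<longrightarrow> app (y n) g = 0" "\<And>n. raag.lb (y n) D"
    by (rule raag.ultra_seqE[of Y]) (use Y in \<open>auto simp: haarU_def\<close>)
  define K where "K = max C D"
  have lx: "raag.lb (x n) K" for n using x(3) by (rule raag.lb_mono) (simp add: K_def)
  have ly: "raag.lb (y n) K" for n using y(3) by (rule raag.lb_mono) (simp add: K_def)
  have X': "(\<lambda>n. app (x n)) = X" and Y': "(\<lambda>n. app (y n)) = Y" using x y by auto
  have ex: "ends_in F True x"
    using ends_in_of_commU[of 0 x K F] x(2) lx X c1 by (simp add: X')
  have ey: "ends_in F False y"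
    using ends_in_of_commU[of 4 y K F] y(2) ly Y raag.commU_sym[OF c3] by (simp add: Y')
  let ?W = "\<lambda>n. raag.cv (x n) (y n)" and ?V = "\<lambda>n. raag.cv (y n) (x n)"
  have W: "((\<lambda>n. norm (restr (- branch True) (?W n))) \<longlongrightarrow> 0) F"
    by (rule ends_in_product[OF x(2) lx y(2) ly ex]) (use ey in simp)
  have V: "((\<lambda>n. norm (restr (- branch False) (?V n))) \<longlongrightarrow> 0) F"
    by (rule ends_in_product[OF y(2) ly x(2) lx ey]) (use ex in simp)
  have d: "((\<lambda>n. norm (?W n - ?V n)) \<longlongrightarrow> 0) F"
  proof -
    have "norm2 raag (\<lambda>g. conv raag (X n) (Y n) g - conv raag (Y n) (X n) g) = norm (?W n - ?V n)" for n
      using raag.norm2_diff[OF raag.lb_carr[OF lx] raag.lb_carr[OF ly], of n "y n" n "x n"]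
      by (simp only: raag.lb_app[OF lx] raag.lb_app[OF ly] x(1) y(1))
    then show ?thesis using c2 by (simp add: commU_def ueq_def)
  qed
  \<comment> \<open>The part of \<open>?W\<close> on \<open>branch True\<close> lies off
    \<open>branch False\<close>, where \<open>?W\<close> differs from \<open>?V\<close> by at most
    the commutator and \<open>?V\<close> is small.\<close>
  have le: "norm (?W n) \<le> norm (restr (- branch True) (?W n)) + (norm (restr (- branch False) (?V n)) + norm (?W n - ?V n))" for n
  proof -
    have "norm (?W n) \<le> norm (restr (- branch True) (?W n)) + norm (restr (branch True) (?W n))"
      using norm_triangle_ineq[of "restr (branch True) (?W n)" "restr (- branch True) (?W n)"]
      by (simp add: restr_add_compl add.commute)
    also have "norm (restr (branch True) (?W n)) \<le> norm (restr (- branch False) (?W n))"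
      using branch_disjoint by (intro norm_mono_app) auto
    also have "restr (- branch False) (?W n) = restr (- branch False) (?V n) + restr (- branch False) (?W n - ?V n)"
      by (rule l2_eqI) simp
    also have "norm \<dots> \<le> norm (restr (- branch False) (?V n)) + norm (restr (- branch False) (?W n - ?V n))"
      by (rule norm_triangle_ineq)
    also have "norm (restr (- branch False) (?W n - ?V n)) \<le> norm (?W n - ?V n)" by (rule norm_restr_le)
    finally show ?thesis by simp
  qed
  have lim: "((\<lambda>n. norm (restr (- branch True) (?W n)) + (norm (restr (- branch False) (?V n)) + norm (?W n - ?V n))) \<longlongrightarrow> 0) F"
    using tendsto_add[OF W tendsto_add[OF V d]] by simp
  have "((\<lambda>n. norm (?W n)) \<longlongrightarrow> 0) F"
    by (rule tendsto_sandwich[OF _ _ tendsto_const lim]) (simp_all add: le)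
  moreover have "\<not> ((\<lambda>n. norm (?W n)) \<longlongrightarrow> 0) F"
    by (rule raag.unitary_product_not_null[OF F x(2) lx y(2) ly])
      (use X Y in \<open>simp_all add: haarU_def x(1) y(1)\<close>)
  ultimately show False by contradiction
qed

section \<open>Chains between the two end generators\<close>

lemma haarU_raag_gen: "i < 5 \<Longrightarrow> (\<lambda>_. delta (raag_gen i)) \<in> haarU raag F"
  by (intro raag.haarU_delta) (simp_all add: raag_gen_pow_neq_one)

lemma commU_raag_gen: "path_adj i j \<Longrightarrow> commU raag F (\<lambda>_. delta (raag_gen i)) (\<lambda>_. delta (raag_gen j))"
  by (intro raag.commU_delta raag_gen_commute) (auto simp: path_adj_def)

lemma haar_chain_four: "haar_chain raag F 4 (delta (raag_gen 0)) (delta (raag_gen 4))"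
  unfolding haar_chain_def
  by (intro exI[of _ "\<lambda>i _. delta (raag_gen i)"] conjI allI impI refl haarU_raag_gen commU_raag_gen)
    (auto simp: path_adj_def)

text \<open>A chain of length one or two is padded to length three by repeating an endpoint, so one
  obstruction excludes all three lengths.\<close>

lemma haar_chain_ge_four:
  assumes F: "F \<noteq> bot" and k: "k \<ge> 1" and chain: "haar_chain raag F k (delta (raag_gen 0)) (delta (raag_gen 4))"
  shows "4 \<le> k"
proof (rule ccontr)
  assume "\<not> 4 \<le> k"
  then consider "k = 1" | "k = 2" | "k = 3" using k by linarith
  moreover obtain W where W: "W 0 = (\<lambda>_. delta (raag_gen 0))" "W k = (\<lambda>_. delta (raag_gen 4))"
      "\<And>i. 0 < i \<Longrightarrow> i < k \<Longrightarrow> W i \<in> haarU raag F" "\<And>i. i < k \<Longrightarrow> commU raag F (W i) (W (Suc i))"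
    using chain by (auto simp: haar_chain_def)
  \<comment> \<open>\<open>haar_chain\<close> asks only the interior terms to be Haar; the padding
    needs it of the endpoints as well.\<close>
  have h: "W 0 \<in> haarU raag F" "W k \<in> haarU raag F" unfolding W by (intro haarU_raag_gen, simp)+
  note no = no_commuting_haar_pair[OF F, folded W(1) W(2)]
  ultimately show False
  proof cases
    case 1
    then show False using no[of "W 0" "W k"] h W(4)[of 0] raag.commU_refl by simp
  next
    case 2
    then show False using no[of "W 1" "W k"] h W(3)[of 1] W(4)[of 0] W(4)[of 1] raag.commU_refl
      by (simp add: numeral_2_eq_2)
  next
    case 3
    then show False using no[of "W 1" "W 2"] W(3)[of 1] W(3)[of 2] W(4)[of 0] W(4)[of 1] W(4)[of 2]
      by (simp add: numeral_2_eq_2 numeral_3_eq_3)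
  qed
qed

theorem theorem6p7:
  fixes F :: "nat filter"
  assumes "free_ultrafilter F"
  shows "pM raag F (delta (raag_gen 0)) (delta (raag_gen 4)) = 4"
proof -
  have F: "F \<noteq> bot" using assms by (simp add: free_ultrafilter_def)
  have "raag_gen 0 \<noteq> raag_gen 4" using raag_gen_inj[of 0 4] by auto
  then have ne: "delta (raag_gen 0) \<noteq> delta (raag_gen 4)" by (auto simp: delta_def fun_eq_iff)
  have "(LEAST k. k \<ge> 1 \<and> haar_chain raag F k (delta (raag_gen 0)) (delta (raag_gen 4))) = 4"
    using haar_chain_four haar_chain_ge_four[OF F] by (intro Least_equality) auto
  moreover have "\<exists>k\<ge>1. haar_chain raag F k (delta (raag_gen 0)) (delta (raag_gen 4))"
    using haar_chain_four by (intro exI[of _ 4]) simp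
  ultimately show ?thesis using ne by (simp add: pM_def numeral_eq_enat)
qed

end
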